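(* Let $m=3$. Then omnivocal communication is necessary for achieving SK capacity, i.e. $\mathbf I_T(X_{\mathcal M})<\mathbf I(X_{\mathcal M})$ for every $T\subset\mathcal M$ with $|T|=2$, if and only if the singleton partition $\mathcal S$ is the unique minimizer in the definition of $\mathbf I(X_{\mathcal M})$. Equivalently, the condition is $$\Delta(\mathcal S)<\min\{I(X_{\{1,2\}};X_3),\,I(X_{\{1,3\}};X_2),\,I(X_{\{2,3\}};X_1)\}.$$
   Context: Let $\mathcal M=\{1,2,3\}$, and let $X_{\mathcal M}=(X_1,X_2,X_3)$ be jointly distributed finite-valued random variables, observed as $n$ i.i.d. copies; $X_A=(X_i:i\in A)$. Communication, CR, SK. An interactive communication $\mathbf F$ is a finite sequence of transmissions, each made by a terminal $i$ as a deterministic function of $X^n_i$ and earlier transmissions. A CR from $\mathbf F$ is a sequence $\mathbf J$ of functions of $X^n_{\mathcal M}$ such that for every $0<\epsilon<1$ and large $n$, there exist $J_i(X^n_i,\mathbf F)$ with $\Pr[J_1=J_2=J_3=\mathbf J]\ge1-\epsilon$. $R$ is an achievable SK rate if some CR $\mathbf K$ from some $\mathbf F$ satisfies, for every $\epsilon>0$ and large $n$, $I(\mathbf K;\mathbf F)\le\epsilon$ and $\frac1nH(\mathbf K)\ge R-\epsilon$. Multipartite information. $\Delta(\mathcal P)=\frac1{|\mathcal P|-1}[\sum_{A\in\mathcal P}H(X_A)-H(X_{\mathcal M})]$, and $\mathbf I(X_{\mathcal M})=\min_{\mathcal P}\Delta(\mathcal P)$ over partitions with at least 2 cells; this equals the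 SK capacity. In particular $\Delta(\mathcal S)=\frac12[H(X_1)+H(X_2)+H(X_3)-H(X_{\mathcal M})]$ for $\mathcal S=\{\{1\},\{2\},\{3\}\}$. Silent terminals. For $T\subsetneq\mathcal M$, $\mathbf I_T(X_{\mathcal M})$ is the supremum of SK rates achievable using interactive communications in which only terminals in $T$ transmit. *)

theory Defs
  imports "HOL-Probability.Probability" "HOL-Library.Disjoint_Sets"
begin

text \<open>Terminals are 1, 2, 3. A realization of n i.i.d. copies of (X1,X2,X3) is a list
  of length n of triples; terminal i observes the i-th component of every triple.\<close>

definition terms :: "nat set" where "terms = {1, 2, 3}"

definition local_eq :: "nat \<Rightarrow> ('a \<times> 'b \<times> 'c) list \<Rightarrow> ('a \<times> 'b \<times> 'c) list \<Rightarrow> bool" where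
  "local_eq i w w' \<longleftrightarrow>
     (i = 1 \<longrightarrow> map fst w = map fst w') \<and>
     (i = 2 \<longrightarrow> map (fst \<circ> snd) w = map (fst \<circ> snd) w') \<and>
     (i = 3 \<longrightarrow> map (snd \<circ> snd) w = map (snd \<circ> snd) w')"

fun iid :: "'x pmf \<Rightarrow> nat \<Rightarrow> 'x list pmf" where
  "iid P 0 = return_pmf []"
| "iid P (Suc n) = bind_pmf P (\<lambda>x. map_pmf (Cons x) (iid P n))"

text \<open>An interactive communication: a finite list of transmissions (sender, rule); the rule
  maps the realization and the earlier transmissions to the transmitted value.\<close>
type_synonym ('a,'b,'c) protocol = "(nat \<times> (('a \<times> 'b \<times> 'c) list \<Rightarrow> nat list \<Rightarrow> nat)) list"

definition run :: "('a,'b,'c) protocol \<Rightarrow> ('a \<times> 'b \<times> 'c) list \<Rightarrow> nat list" where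
  "run ps w = foldl (\<lambda>ms (i, f). ms @ [f w ms]) [] ps"

definition valid_protocol :: "nat set \<Rightarrow> ('a,'b,'c) protocol \<Rightarrow> bool" where
  "valid_protocol T ps \<longleftrightarrow>
     (\<forall>(i, f) \<in> set ps. i \<in> T \<and> (\<forall>w w' ms. local_eq i w w' \<longrightarrow> f w ms = f w' ms))"

definition ent :: "'x pmf \<Rightarrow> real" where
  "ent p = - (\<Sum>x\<in>set_pmf p. pmf p x * log 2 (pmf p x))"

definition mutinf :: "'w pmf \<Rightarrow> ('w \<Rightarrow> 'u) \<Rightarrow> ('w \<Rightarrow> 'v) \<Rightarrow> real" where
  "mutinf p f g = ent (map_pmf f p) + ent (map_pmf g p) - ent (map_pmf (\<lambda>w. (f w, g w)) p)"

definition is_CR :: "('a \<times> 'b \<times> 'c) pmf \<Rightarrow> (nat \<Rightarrow> ('a,'b,'c) protocol)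
                    \<Rightarrow> (nat \<Rightarrow> ('a \<times> 'b \<times> 'c) list \<Rightarrow> nat) \<Rightarrow> bool" where
  "is_CR P ps J \<longleftrightarrow>
     (\<forall>\<epsilon>. 0 < \<epsilon> \<and> \<epsilon> < 1 \<longrightarrow>
        (\<forall>\<^sub>F n in sequentially.
           \<exists>Jl :: nat \<Rightarrow> ('a \<times> 'b \<times> 'c) list \<Rightarrow> nat.
             (\<forall>i\<in>terms. \<forall>w w'. local_eq i w w' \<and> run (ps n) w = run (ps n) w' \<longrightarrow> Jl i w = Jl i w') \<and>
             measure_pmf.prob (iid P n) {w. \<forall>i\<in>terms. Jl i w = J n w} \<ge> 1 - \<epsilon>))"

definition sk_achievable :: "('a \<times> 'b \<times> 'c) pmf \<Rightarrow> nat set \<Rightarrow> real \<Rightarrow> bool" where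
  "sk_achievable P T R \<longleftrightarrow>
     (\<exists>(ps :: nat \<Rightarrow> ('a,'b,'c) protocol) (K :: nat \<Rightarrow> ('a \<times> 'b \<times> 'c) list \<Rightarrow> nat).
        (\<forall>n. valid_protocol T (ps n)) \<and> is_CR P ps K \<and>
        (\<forall>\<epsilon>>0. \<forall>\<^sub>F n in sequentially.
            mutinf (iid P n) (K n) (run (ps n)) \<le> \<epsilon> \<and>
            ent (map_pmf (K n) (iid P n)) / real n \<ge> R - \<epsilon>))"

definition sk_cap_T :: "('a \<times> 'b \<times> 'c) pmf \<Rightarrow> nat set \<Rightarrow> real" where
  "sk_cap_T P T = Sup {R. sk_achievable P T R}"

definition proj :: "nat set \<Rightarrow> 'a \<times> 'b \<times> 'c \<Rightarrow> 'a option \<times> 'b option \<times> 'c option" where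
  "proj A x = (if 1 \<in> A then Some (fst x) else None,
               if 2 \<in> A then Some (fst (snd x)) else None,
               if 3 \<in> A then Some (snd (snd x)) else None)"

definition HA :: "('a \<times> 'b \<times> 'c) pmf \<Rightarrow> nat set \<Rightarrow> real" where
  "HA P A = ent (map_pmf (proj A) P)"

definition Delta :: "('a \<times> 'b \<times> 'c) pmf \<Rightarrow> nat set set \<Rightarrow> real" where
  "Delta P Q = ((\<Sum>A\<in>Q. HA P A) - HA P terms) / (real (card Q) - 1)"

definition admissible_partition :: "nat set set \<Rightarrow> bool" where
  "admissible_partition Q \<longleftrightarrow> partition_on terms Q \<and> card Q \<ge> 2"

definition mmi :: "('a \<times> 'b \<times> 'c) pmf \<Rightarrow> real" where
  "mmi P = Min (Delta P ` {Q. admissible_partition Q})"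

definition singleton_partition :: "nat set set" where
  "singleton_partition = {{1}, {2}, {3}}"

end

theory Submission
  imports Defs
begin

text \<open>Write \<open>I(i;j)\<close> and \<open>I(ij;k)\<close> for the obvious mutual informations. Since
  \<open>2 \<Delta>(S) = I(i;j) + I(ij;k)\<close>, the inequality \<open>\<Delta>(S) < I(ij;k)\<close> is the same as \<open>I(i;j) < \<Delta>(S)\<close>.
  If only \<open>i\<close> and \<open>j\<close> transmit, the secret key rate is at most \<open>I(i;j)\<close>: a transcript \<open>F\<close> never
  increases the mutual information of \<open>X\<^sub>i\<close> and \<open>X\<^sub>j\<close>, and by Fano's inequality the key is almost a
  function of \<open>(X\<^sub>i, F)\<close> and of \<open>(X\<^sub>j, F)\<close>. Conversely, if \<open>I(ij;k) \<le> I(i;j)\<close>, then random binning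
  of \<open>X\<^sub>i\<close> and of \<open>X\<^sub>j\<close> makes \<open>(X\<^sub>i, X\<^sub>j)\<close> known everywhere at total rate \<open>H(ij) - I(ij;k)\<close>, and a
  further random hash of \<open>(X\<^sub>i, X\<^sub>j)\<close> is a key of rate \<open>I(ij;k)\<close>. Decoding errors and leakage are
  bounded by moments \<open>E[\<phi>\<^sup>t]\<close> of likelihoods, which are exactly multiplicative over i.i.d. copies;
  differentiating at \<open>t = 0\<close> turns them into entropies, so no typical sets are needed and the
  leakage decays exponentially, as strong secrecy requires.\<close>

section \<open>Entropy of finitely supported distributions\<close>

abbreviation expec :: "'x pmf \<Rightarrow> ('x \<Rightarrow> real) \<Rightarrow> real" where
  "expec p f \<equiv> measure_pmf.expectation p f"

lemma expec_eq_sum: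
  assumes "finite (set_pmf p)"
  shows "expec p f = (\<Sum>x\<in>set_pmf p. pmf p x * f x)"
  by (subst integral_measure_pmf[OF assms]) auto

lemma expec_mono:
  assumes "finite (set_pmf p)" "\<And>x. x \<in> set_pmf p \<Longrightarrow> f x \<le> g x"
  shows "expec p f \<le> expec p g"
  unfolding expec_eq_sum[OF assms(1)] by (intro sum_mono mult_left_mono assms) auto

lemma expec_cong:
  assumes "finite (set_pmf p)" "\<And>x. x \<in> set_pmf p \<Longrightarrow> f x = g x"
  shows "expec p f = expec p g"
  unfolding expec_eq_sum[OF assms(1)] by (intro sum.cong) (simp_all add: assms)

lemma expec_add:
  assumes "finite (set_pmf p)"
  shows "expec p (\<lambda>x. f x + g x) = expec p f + expec p g"
  unfolding expec_eq_sum[OF assms] by (simp add: algebra_simps sum.distrib)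

lemma expec_diff:
  assumes "finite (set_pmf p)"
  shows "expec p (\<lambda>x. f x - g x) = expec p f - expec p g"
  unfolding expec_eq_sum[OF assms] by (simp add: algebra_simps sum_subtractf)

lemma expec_swap:
  assumes "finite (set_pmf p)" "finite (set_pmf q)"
  shows "expec p (\<lambda>x. expec q (\<lambda>y. f x y)) = expec q (\<lambda>y. expec p (\<lambda>x. f x y))"
  unfolding expec_eq_sum[OF assms(1)] expec_eq_sum[OF assms(2)]
  by (simp add: sum_distrib_left sum.swap[of _ "set_pmf p"] mult_ac)

text \<open>The derandomization step of random coding: some seed in the support does no worse than
  the average seed.\<close>

lemma exists_le_expec:
  assumes "finite (set_pmf p)"
  shows "\<exists>x\<in>set_pmf p. f x \<le> expec p f"
proof (rule ccontr)
  assume "\<not> ?thesis"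
  then have *: "\<And>x. x \<in> set_pmf p \<Longrightarrow> expec p f < f x" by (meson not_le)
  have "(\<Sum>x\<in>set_pmf p. pmf p x * expec p f) < (\<Sum>x\<in>set_pmf p. pmf p x * f x)"
    by (rule sum_strict_mono) (use assms * in \<open>auto simp: set_pmf_not_empty pmf_positive\<close>)
  then show False
    using sum_pmf_eq_1[OF assms order_refl] by (simp add: expec_eq_sum[OF assms, symmetric] sum_distrib_right[symmetric])
qed

lemma ent_eq_expec:
  assumes "finite (set_pmf p)"
  shows "ent p = expec p (\<lambda>x. - log 2 (pmf p x))"
  unfolding ent_def expec_eq_sum[OF assms] by (simp add: sum_negf)

lemma ent_map_eq_expec:
  assumes "finite (set_pmf p)"
  shows "ent (map_pmf f p) = expec p (\<lambda>x. - log 2 (pmf (map_pmf f p) (f x)))"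
  using assms by (subst ent_eq_expec) auto

lemma log2_le_minus_one: "0 < x \<Longrightarrow> log 2 x \<le> (x - 1) / ln 2"
  using ln_le_minus_one[of x] by (simp add: log_def divide_right_mono)

text \<open>Gibbs' inequality for a subprobability \<open>q\<close>, from
  \<open>log 2 x \<le> (x - 1) / ln 2\<close>. Later entropy bounds are choices of \<open>q\<close>:
  uniform for the cardinality bound, conditionally independent for submodularity, two-level for
  Fano.\<close>

lemma ent_le_cross_entropy:
  assumes fin: "finite (set_pmf p)" and pos: "\<And>x. x \<in> set_pmf p \<Longrightarrow> 0 < q x"
    and sum: "(\<Sum>x\<in>set_pmf p. q x) \<le> 1"
  shows "ent p \<le> expec p (\<lambda>x. - log 2 (q x))"
proof -
  have "ent p - expec p (\<lambda>x. - log 2 (q x)) = expec p (\<lambda>x. log 2 (q x / pmf p x))"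
    unfolding ent_eq_expec[OF fin] expec_diff[OF fin, symmetric]
    by (intro expec_cong fin) (simp add: log_divide pmf_positive pos less_imp_neq[symmetric])
  also have "\<dots> \<le> expec p (\<lambda>x. (q x / pmf p x - 1) / ln 2)"
    by (intro expec_mono fin log2_le_minus_one) (simp add: pos pmf_positive)
  also have "\<dots> = (\<Sum>x\<in>set_pmf p. (q x - pmf p x) / ln 2)"
    unfolding expec_eq_sum[OF fin] by (intro sum.cong) (auto simp: field_simps set_pmf_iff)
  also have "\<dots> = ((\<Sum>x\<in>set_pmf p. q x) - 1) / ln 2"
    using sum_pmf_eq_1[OF fin order_refl] by (simp add: sum_divide_distrib[symmetric] sum_subtractf)
  also have "\<dots> \<le> 0"
    using sum by (simp add: divide_nonpos_pos)
  finally show ?thesis by simp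
qed

lemma ent_le_log_card:
  assumes fin: "finite A" and sub: "set_pmf p \<subseteq> A"
  shows "ent p \<le> log 2 (card A)"
proof -
  have f: "finite (set_pmf p)" using assms finite_subset by blast
  have "A \<noteq> {}" using sub set_pmf_not_empty[of p] by auto
  then have c: "card A > 0" using fin by (simp add: card_gt_0_iff)
  have "ent p \<le> expec p (\<lambda>x. - log 2 (1 / card A))"
    by (rule ent_le_cross_entropy) (use f c card_mono[OF fin sub] in auto)
  then show ?thesis using c by (simp add: log_divide)
qed

text \<open>Up to a null set, the fibre of \<open>f\<close> through \<open>x\<close> lies inside the
  fibre of \<open>g\<close> through \<open>x\<close>.\<close>

lemma pmf_map_mono:
  assumes "\<And>y. y \<in> set_pmf p \<Longrightarrow> f y = f x \<Longrightarrow> g y = g x"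
  shows "pmf (map_pmf f p) (f x) \<le> pmf (map_pmf g p) (g x)"
  unfolding pmf_map
  by (intro measure_pmf.finite_measure_mono_AE) (auto simp: AE_measure_pmf_iff assms)

lemma pmf_map_pos: "x \<in> set_pmf p \<Longrightarrow> 0 < pmf (map_pmf f p) (f x)"
  by (auto intro!: pmf_positive)

lemma ent_map_mono:
  assumes fin: "finite (set_pmf p)"
    and "\<And>x y. x \<in> set_pmf p \<Longrightarrow> y \<in> set_pmf p \<Longrightarrow> f x = f y \<Longrightarrow> g x = g y"
  shows "ent (map_pmf g p) \<le> ent (map_pmf f p)"
  unfolding ent_map_eq_expec[OF fin]
  by (intro expec_mono fin) (auto simp: pmf_map_pos intro!: pmf_map_mono assms(2))

text \<open>Entropy depends only on the partition that a variable induces on the support. This lets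
  tuples be reordered, regrouped, or extended by components that they already determine.\<close>

lemma ent_map_cong:
  assumes fin: "finite (set_pmf p)"
    and "\<And>x y. x \<in> set_pmf p \<Longrightarrow> y \<in> set_pmf p \<Longrightarrow> f x = f y \<longleftrightarrow> g x = g y"
  shows "ent (map_pmf g p) = ent (map_pmf f p)"
  by (intro antisym ent_map_mono fin) (simp_all add: assms)

lemma sum_pmf_map_pair:
  assumes fin: "finite (set_pmf p)"
  shows "(\<Sum>a\<in>f ` set_pmf p. pmf (map_pmf (\<lambda>x. (f x, h x)) p) (a, c)) = pmf (map_pmf h p) c"
proof -
  have "pmf (map_pmf h p) c = measure p (\<Union>a\<in>f ` set_pmf p. (\<lambda>x. (f x, h x)) -` {(a, c)})"
    unfolding pmf_map by (intro measure_pmf.finite_measure_eq_AE) (auto simp: AE_measure_pmf_iff)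
  also have "\<dots> = (\<Sum>a\<in>f ` set_pmf p. measure p ((\<lambda>x. (f x, h x)) -` {(a, c)}))"
    using fin by (intro measure_pmf.finite_measure_finite_Union) (auto simp: disjoint_family_on_def)
  finally show ?thesis by (simp add: pmf_map)
qed

text \<open>Nonnegativity of the conditional mutual information \<open>I(f; g | h)\<close>. The
  reference weight \<open>q\<close> in Gibbs' inequality keeps the laws of \<open>(f, h)\<close> and
  \<open>(g, h)\<close> but makes \<open>f\<close> and \<open>g\<close> independent given
  \<open>h\<close>.\<close>

lemma ent_submodular:
  assumes fin: "finite (set_pmf p)"
  shows "ent (map_pmf (\<lambda>x. (f x, g x, h x)) p) + ent (map_pmf h p)
    \<le> ent (map_pmf (\<lambda>x. (f x, h x)) p) + ent (map_pmf (\<lambda>x. (g x, h x)) p)"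
proof -
  define PF where "PF = pmf (map_pmf (\<lambda>x. (f x, h x)) p)"
  define PG where "PG = pmf (map_pmf (\<lambda>x. (g x, h x)) p)"
  define PH where "PH = pmf (map_pmf h p)"
  define q where "q = (\<lambda>(a,b,c). PF (a,c) * PG (b,c) / PH c)"
  let ?r = "map_pmf (\<lambda>x. (f x, g x, h x)) p"
  let ?A = "f ` set_pmf p" and ?B = "g ` set_pmf p" and ?C = "h ` set_pmf p"
  have pos: "0 < PF (f x, h x)" "0 < PG (g x, h x)" "0 < PH (h x)" if "x \<in> set_pmf p" for x
    unfolding PF_def PG_def PH_def
    using pmf_map_pos[OF that, of "\<lambda>x. (f x, h x)"] pmf_map_pos[OF that, of "\<lambda>x. (g x, h x)"]
      pmf_map_pos[OF that, of h] by auto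
  \<comment> \<open>Passing from the joint support to the product of the ranges lets the sum factor
    for each fixed \<open>c\<close>.\<close>
  have "(\<Sum>z\<in>set_pmf ?r. q z) \<le> (\<Sum>z\<in>?A \<times> ?B \<times> ?C. q z)"
    by (intro sum_mono2) (use fin in \<open>auto simp: q_def PF_def PG_def PH_def\<close>)
  also have "\<dots> = (\<Sum>c\<in>?C. \<Sum>b\<in>?B. \<Sum>a\<in>?A. PF (a,c) * PG (b,c) / PH c)"
    by (simp add: q_def sum.cartesian_product[symmetric] sum.swap[of _ ?A] sum.swap[of _ ?B ?C])
  also have "\<dots> = (\<Sum>c\<in>?C. (\<Sum>a\<in>?A. PF (a,c)) * (\<Sum>b\<in>?B. PG (b,c)) / PH c)"
    by (simp add: sum_product sum_divide_distrib sum.swap[of _ ?A])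
  also have "\<dots> = (\<Sum>c\<in>?C. PH c)"
    by (intro sum.cong) (auto simp: PF_def PG_def PH_def sum_pmf_map_pair[OF fin])
  also have "\<dots> = 1"
    unfolding PH_def by (intro sum_pmf_eq_1) (use fin in auto)
  finally have le: "(\<Sum>z\<in>set_pmf ?r. q z) \<le> 1" .
  have "ent ?r \<le> expec ?r (\<lambda>z. - log 2 (q z))"
    by (rule ent_le_cross_entropy) (use fin le pos in \<open>auto simp: q_def\<close>)
  also have "\<dots> = expec p (\<lambda>x. - log 2 (PF (f x, h x)) + - log 2 (PG (g x, h x)) - - log 2 (PH (h x)))"
    unfolding integral_map_pmf
    by (intro expec_cong fin) (auto simp: q_def log_mult log_divide dest: pos)
  also have "\<dots> = ent (map_pmf (\<lambda>x. (f x, h x)) p) + ent (map_pmf (\<lambda>x. (g x, h x)) p) - ent (map_pmf h p)"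
    unfolding expec_diff[OF fin] expec_add[OF fin] ent_map_eq_expec[OF fin] PF_def PG_def PH_def ..
  finally show ?thesis by simp
qed

lemma ent_return: "ent (return_pmf c) = 0"
  by (simp add: ent_def)

lemma ent_subadditive:
  assumes fin: "finite (set_pmf p)"
  shows "ent (map_pmf (\<lambda>x. (f x, g x)) p) \<le> ent (map_pmf f p) + ent (map_pmf g p)"
proof -
  have "ent (map_pmf (\<lambda>x. (f x, g x, ())) p) + ent (map_pmf (\<lambda>_. ()) p)
    \<le> ent (map_pmf (\<lambda>x. (f x, ())) p) + ent (map_pmf (\<lambda>x. (g x, ())) p)"
    by (rule ent_submodular[OF fin])
  moreover have "ent (map_pmf (\<lambda>x. (f x, g x, ())) p) = ent (map_pmf (\<lambda>x. (f x, g x)) p)"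
    "ent (map_pmf (\<lambda>x. (f x, ())) p) = ent (map_pmf f p)"
    "ent (map_pmf (\<lambda>x. (g x, ())) p) = ent (map_pmf g p)"
    by (rule ent_map_cong[OF fin]; auto)+
  ultimately show ?thesis by (simp add: ent_return)
qed

text \<open>The correction variable \<open>G\<close> is \<open>None\<close> where \<open>J\<close>
  is right and reveals \<open>K\<close> where it is wrong, so \<open>(J, G)\<close> determines
  \<open>K\<close>. Its entropy is small because errors are rare.\<close>

lemma fano:
  assumes fin: "finite (set_pmf p)" and card: "card (K ` set_pmf p) \<le> N"
    and prob: "measure_pmf.prob p {x. J x = K x} \<ge> 1 - \<epsilon>"
  shows "ent (map_pmf (\<lambda>x. (K x, J x)) p) \<le> ent (map_pmf J p) + 1 + \<epsilon> * log 2 N"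
proof -
  define G where "G x = (if J x = K x then None else Some (K x))" for x
  have N: "N \<ge> 1" using card fin set_pmf_not_empty[of p] card_gt_0_iff[of "K ` set_pmf p"] by (auto simp: Suc_le_eq)
  \<comment> \<open>Half of the weight on \<open>None\<close> costs one bit always; the other half,
    spread over at most \<open>N\<close> values, costs \<open>log 2 N\<close> more bits only on
    errors.\<close>
  define q where "q = (\<lambda>g::'b option. if g = None then 1 / 2 else 1 / (2 * real N))"
  let ?G = "map_pmf G p"
  have "set_pmf ?G \<subseteq> insert None (Some ` K ` set_pmf p)" by (auto simp: G_def)
  then have "(\<Sum>g\<in>set_pmf ?G. q g) \<le> (\<Sum>g\<in>insert None (Some ` K ` set_pmf p). q g)"
    by (intro sum_mono2) (use fin in \<open>auto simp: q_def\<close>)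
  also have "\<dots> = 1 / 2 + (\<Sum>k\<in>K ` set_pmf p. 1 / (2 * real N))"
    using fin by (subst sum.insert) (auto simp: q_def sum.reindex)
  also have "\<dots> \<le> 1" using card N by (simp add: field_simps)
  finally have le: "(\<Sum>g\<in>set_pmf ?G. q g) \<le> 1" .
  have "ent ?G \<le> expec ?G (\<lambda>g. - log 2 (q g))"
    by (rule ent_le_cross_entropy) (use fin le N in \<open>auto simp: q_def\<close>)
  also have "\<dots> = expec p (\<lambda>x. 1 + log 2 N * (1 - indicator {x. J x = K x} x))"
    unfolding integral_map_pmf
    by (intro expec_cong fin) (use N in \<open>auto simp: q_def G_def log_divide log_mult\<close>)
  also have "\<dots> = 1 + log 2 N * (1 - measure_pmf.prob p {x. J x = K x})"
    by (simp add: integrable_measure_pmf_finite[OF fin])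
  also have "\<dots> \<le> 1 + log 2 N * \<epsilon>"
    using prob N by (intro add_left_mono mult_left_mono) auto
  finally have G: "ent ?G \<le> 1 + \<epsilon> * log 2 N" by (simp add: mult_ac)
  have "ent (map_pmf (\<lambda>x. (K x, J x)) p) \<le> ent (map_pmf (\<lambda>x. (J x, G x)) p)"
    by (rule ent_map_mono[OF fin]) (auto simp: G_def split: if_splits)
  also have "\<dots> \<le> ent (map_pmf J p) + ent ?G" by (rule ent_subadditive[OF fin])
  finally show ?thesis using G by simp
qed

section \<open>The converse bound\<close>

lemma expec_pair:
  assumes "finite (set_pmf p)" "finite (set_pmf q)"
  shows "expec (pair_pmf p q) f = expec p (\<lambda>x. expec q (\<lambda>y. f (x, y)))"
proof -
  have "finite (set_pmf (pair_pmf p q))" using assms by simp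
  then show ?thesis
    unfolding expec_eq_sum[OF assms(1)] expec_eq_sum[OF assms(2)]
    by (subst expec_eq_sum) (auto simp: sum_distrib_left sum.cartesian_product pmf_pair mult_ac intro!: sum.cong)
qed

lemma iid_Suc_pair: "iid P (Suc n) = map_pmf (\<lambda>(x, w). x # w) (pair_pmf P (iid P n))"
  by (simp add: pair_pmf_def map_pmf_def bind_assoc_pmf bind_return_pmf)

lemma set_iid: "set_pmf (iid P n) = {w. length w = n \<and> set w \<subseteq> set_pmf P}"
proof (induction n)
  case (Suc n)
  then show ?case by (auto simp: length_Suc_conv image_iff)
qed auto

lemma finite_set_iid: "finite (set_pmf P) \<Longrightarrow> finite (set_pmf (iid P n))"
  using finite_lists_length_eq[of "set_pmf P" n] by (simp add: set_iid conj_commute)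

lemma map_iid: "map_pmf (map f) (iid P n) = iid (map_pmf f P) n"
proof (induction n)
  case (Suc n)
  have "map_pmf (map f) (map_pmf (Cons x) (iid P n)) = map_pmf (Cons (f x)) (iid (map_pmf f P) n)" for x
    by (simp add: Suc[symmetric] pmf.map_comp o_def)
  then show ?case by (simp add: map_bind_pmf bind_map_pmf)
qed simp

lemma expec_iid_Suc:
  assumes "finite (set_pmf P)"
  shows "expec (iid P (Suc n)) f = expec P (\<lambda>x. expec (iid P n) (\<lambda>w. f (x # w)))"
  unfolding iid_Suc_pair integral_map_pmf expec_pair[OF assms finite_set_iid[OF assms]] by simp

lemma expec_iid_sum_list:
  assumes fin: "finite (set_pmf P)"
  shows "expec (iid P n) (\<lambda>w. sum_list (map \<psi> w)) = n * expec P \<psi>"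
proof (induction n)
  case (Suc n)
  show ?case
    unfolding expec_iid_Suc[OF fin]
    by (simp add: expec_add[OF finite_set_iid[OF fin]] expec_add[OF fin] Suc algebra_simps)
qed simp

lemma expec_iid_prod_list:
  fixes \<phi> :: "'x \<Rightarrow> real"
  assumes fin: "finite (set_pmf P)"
  shows "expec (iid P n) (\<lambda>w. prod_list (map \<phi> w)) = expec P \<phi> ^ n"
proof (induction n)
  case (Suc n)
  show ?case unfolding expec_iid_Suc[OF fin] by (simp add: Suc)
qed simp

lemma pmf_iid:
  assumes "length w = n"
  shows "pmf (iid P n) w = prod_list (map (pmf P) w)"
  using assms
proof (induction n arbitrary: w)
  case (Suc n)
  then obtain x v where w: "w = x # v" and v: "length v = n" by (auto simp: length_Suc_conv)
  have "pmf (iid P (Suc n)) w = pmf (map_pmf (\<lambda>(x, w). x # w) (pair_pmf P (iid P n))) ((\<lambda>(x, w). x # w) (x, v))"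
    unfolding iid_Suc_pair w by simp
  also have "\<dots> = pmf (pair_pmf P (iid P n)) (x, v)"
    by (rule pmf_map_inj') (auto simp: inj_def)
  finally show ?case by (simp add: pmf_pair w Suc.IH[OF v])
qed simp

lemma prod_list_map_pos:
  fixes \<phi> :: "'x \<Rightarrow> real"
  assumes "\<And>x. x \<in> set w \<Longrightarrow> 0 < \<phi> x"
  shows "0 < prod_list (map \<phi> w)"
  using assms by (induction w) auto

lemma minus_log_prod_list:
  assumes "\<And>x. x \<in> set w \<Longrightarrow> 0 < \<phi> x"
  shows "- log 2 (prod_list (map \<phi> w)) = sum_list (map (\<lambda>x. - log 2 (\<phi> x)) w)"
  using assms
proof (induction w)
  case (Cons x w)
  then have "0 < \<phi> x" "0 < prod_list (map \<phi> w)" by (auto intro: prod_list_map_pos)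
  then have "- log 2 (prod_list (map \<phi> (x # w))) = - log 2 (\<phi> x) + - log 2 (prod_list (map \<phi> w))"
    by (simp add: log_mult)
  then show ?case using Cons by simp
qed simp

text \<open>Likelihoods multiply, so the information content of a sequence is a sum over its
  positions, each of mean \<open>ent P\<close>.\<close>

lemma ent_iid:
  assumes fin: "finite (set_pmf P)"
  shows "ent (iid P n) = n * ent P"
proof -
  have "ent (iid P n) = expec (iid P n) (\<lambda>w. sum_list (map (\<lambda>x. - log 2 (pmf P x)) w))"
    unfolding ent_eq_expec[OF finite_set_iid[OF fin]]
    by (intro expec_cong finite_set_iid fin)
       (auto simp: set_iid pmf_iid pmf_positive subset_iff intro!: minus_log_prod_list)
  then show ?thesis by (simp add: expec_iid_sum_list[OF fin] ent_eq_expec[OF fin])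
qed

lemma ent_map_proj_iid:
  fixes P :: "('a::finite \<times> 'b::finite \<times> 'c::finite) pmf"
  shows "ent (map_pmf (map (proj A)) (iid P n)) = n * HA P A"
  unfolding map_iid HA_def by (rule ent_iid) simp

section \<open>Observations as coordinate projections\<close>

lemma map_eq_map_iff:
  assumes "\<And>x y. f x = f y \<longleftrightarrow> g x = g y"
  shows "map f w = map f w' \<longleftrightarrow> map g w = map g w'"
proof (induction w arbitrary: w')
  case (Cons x w)
  then show ?case by (cases w') (simp_all add: assms)
qed simp

text \<open>From here on, terminal \<open>i\<close> observes \<open>map (proj {i})\<close>, one
  function family of uniform type. For indices outside \<open>terms\<close>, \<open>local_eq\<close>
  is vacuously true while the mapped list still reveals its length.\<close>

lemma local_eq_iff:
  fixes w w' :: "('a \<times> 'b \<times> 'c) list"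
  assumes "i \<in> terms"
  shows "local_eq i w w' \<longleftrightarrow> map (proj {i}) w = map (proj {i}) w'"
proof -
  have "map fst w = map fst w' \<longleftrightarrow> map (proj {1}) w = map (proj {1}) w'"
    "map (fst \<circ> snd) w = map (fst \<circ> snd) w' \<longleftrightarrow> map (proj {2}) w = map (proj {2}) w'"
    "map (snd \<circ> snd) w = map (snd \<circ> snd) w' \<longleftrightarrow> map (proj {3}) w = map (proj {3}) w'"
    by (rule map_eq_map_iff; simp add: proj_def)+
  with assms show ?thesis by (auto simp only: terms_def local_eq_def insert_iff empty_iff)
qed

lemma proj_Un_eq_iff: "proj (A \<union> B) x = proj (A \<union> B) y \<longleftrightarrow> proj A x = proj A y \<and> proj B x = proj B y"
  by (auto simp: proj_def)

lemma map_proj_Un_eq_iff: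
  "map (proj (A \<union> B)) w = map (proj (A \<union> B)) w' \<longleftrightarrow> map (proj A) w = map (proj A) w' \<and> map (proj B) w = map (proj B) w'"
proof (induction w arbitrary: w')
  case (Cons x w)
  then show ?case by (cases w') (auto simp: proj_Un_eq_iff)
qed simp

text \<open>One message \<open>m\<close> sent by the holder of \<open>A\<close>. Next to
  \<open>(A, F)\<close> it adds no entropy, while conditioning on it can only reduce the entropy of
  \<open>B\<close> given \<open>F\<close>.\<close>

lemma ent_transmission_step:
  assumes fin: "finite (set_pmf p)"
    and m: "\<And>x y. x \<in> set_pmf p \<Longrightarrow> y \<in> set_pmf p \<Longrightarrow> A x = A y \<Longrightarrow> F x = F y \<Longrightarrow> m x = m y"
    and F': "\<And>x y. F' x = F' y \<longleftrightarrow> F x = F y \<and> m x = m y"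
  shows "ent (map_pmf (\<lambda>x. (A x, F' x)) p) + ent (map_pmf (\<lambda>x. (B x, F' x)) p) - ent (map_pmf F' p)
    \<le> ent (map_pmf (\<lambda>x. (A x, F x)) p) + ent (map_pmf (\<lambda>x. (B x, F x)) p) - ent (map_pmf F p)"
proof -
  have "ent (map_pmf (\<lambda>x. (A x, F' x)) p) = ent (map_pmf (\<lambda>x. (A x, F x)) p)"
    by (rule ent_map_cong[OF fin]) (simp only: prod.inject F', blast dest: m)
  moreover have "ent (map_pmf (\<lambda>x. (B x, F' x)) p) = ent (map_pmf (\<lambda>x. (B x, m x, F x)) p)"
    by (rule ent_map_cong[OF fin]) (auto simp only: prod.inject F')
  moreover have "ent (map_pmf F' p) = ent (map_pmf (\<lambda>x. (m x, F x)) p)"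
    by (rule ent_map_cong[OF fin]) (auto simp only: prod.inject F')
  ultimately show ?thesis using ent_submodular[OF fin, of B m F] by simp
qed

text \<open>That is, \<open>I(A; B | F) \<le> I(A; B)\<close> for the transcript \<open>F\<close>, which is a function of \<open>(A, B)\<close>.\<close>
lemma ent_interactive_communication:
  fixes p :: "('a \<times> 'b \<times> 'c) list pmf"
  assumes fin: "finite (set_pmf p)" and ij: "i \<in> terms" "j \<in> terms" and "valid_protocol {i, j} ps"
  defines "A \<equiv> map (proj {i})" and "B \<equiv> map (proj {j})"
  shows "ent (map_pmf (\<lambda>w. (A w, run ps w)) p) + ent (map_pmf (\<lambda>w. (B w, run ps w)) p) - ent (map_pmf (run ps) p)
      \<le> ent (map_pmf A p) + ent (map_pmf B p)"
  using assms(4)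
\<comment> \<open>Induction on the last transmission: removing it leaves a complete earlier
  transcript, on which the message may depend.\<close>
proof (induction ps rule: rev_induct)
  case Nil
  have "ent (map_pmf (\<lambda>w. (A w, [] :: nat list)) p) = ent (map_pmf A p)"
    "ent (map_pmf (\<lambda>w. (B w, [] :: nat list)) p) = ent (map_pmf B p)"
    by (rule ent_map_cong[OF fin]; auto)+
  then show ?case by (simp add: run_def ent_return)
next
  case (snoc tr ps)
  obtain l f where tr: "tr = (l, f)" by (cases tr)
  have l: "l \<in> {i, j}" and loc: "\<And>w w' ms. local_eq l w w' \<Longrightarrow> f w ms = f w' ms"
    and ps: "valid_protocol {i, j} ps"
    using snoc.prems by (auto simp: valid_protocol_def tr)
  have run: "run (ps @ [tr]) w = run ps w @ [f w (run ps w)]" for w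
    by (simp add: run_def tr)
  have eq: "run (ps @ [tr]) w = run (ps @ [tr]) w' \<longleftrightarrow> run ps w = run ps w' \<and> f w (run ps w) = f w' (run ps w')" for w w'
    by (auto simp: run)
  consider "l = i" | "l = j" using l by auto
  then show ?case
  proof cases
    case 1
    have "A w = A w' \<Longrightarrow> run ps w = run ps w' \<Longrightarrow> f w (run ps w) = f w' (run ps w')" for w w'
      using loc[of w w'] 1 ij by (simp add: local_eq_iff A_def)
    from ent_transmission_step[where A = A and B = B and F = "run ps" and m = "\<lambda>w. f w (run ps w)", OF fin this eq]
    show ?thesis using snoc.IH[OF ps] by simp
  next
    \<comment> \<open>The quantity is symmetric in \<open>A\<close> and \<open>B\<close>, so they
      swap roles when \<open>j\<close> transmits.\<close>
    case 2
    have "B w = B w' \<Longrightarrow> run ps w = run ps w' \<Longrightarrow> f w (run ps w) = f w' (run ps w')" for w w'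
      using loc[of w w'] 2 ij by (simp add: local_eq_iff B_def)
    from ent_transmission_step[where A = B and B = A and F = "run ps" and m = "\<lambda>w. f w (run ps w)", OF fin this eq]
    show ?thesis using snoc.IH[OF ps] by simp
  qed
qed

lemma local_eq_run:
  assumes "valid_protocol T ps" "\<And>t. t \<in> T \<Longrightarrow> local_eq t w w'"
  shows "run ps w = run ps w'"
  using assms(1)
proof (induction ps rule: rev_induct)
  case (snoc tr ps)
  obtain l f where tr: "tr = (l, f)" by (cases tr)
  have "f w ms = f w' ms" for ms using snoc.prems assms(2)[of l] by (auto simp: valid_protocol_def tr)
  moreover have "run ps w = run ps w'" using snoc by (auto simp: valid_protocol_def)
  ultimately show ?case by (simp add: run_def tr)
qed (simp add: run_def)

text \<open>The estimate \<open>J\<close> is a function of \<open>(A, F)\<close>, so conditioning on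
  \<open>(A, F)\<close> leaves no more uncertainty about \<open>K\<close> than conditioning on
  \<open>J\<close> does.\<close>

lemma ent_common_randomness_le:
  assumes fin: "finite (set_pmf p)"
    and J: "\<And>x y. A x = A y \<Longrightarrow> F x = F y \<Longrightarrow> J x = J y"
    and fano: "ent (map_pmf (\<lambda>x. (K x, J x)) p) \<le> ent (map_pmf J p) + \<delta>"
  shows "ent (map_pmf (\<lambda>x. (K x, A x, F x)) p) \<le> ent (map_pmf (\<lambda>x. (A x, F x)) p) + \<delta>"
proof -
  have "ent (map_pmf (\<lambda>x. (K x, (A x, F x), J x)) p) + ent (map_pmf J p) \<le>
    ent (map_pmf (\<lambda>x. (K x, J x)) p) + ent (map_pmf (\<lambda>x. ((A x, F x), J x)) p)"
    by (rule ent_submodular[OF fin])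
  moreover have "ent (map_pmf (\<lambda>x. (K x, (A x, F x), J x)) p) = ent (map_pmf (\<lambda>x. (K x, A x, F x)) p)"
    "ent (map_pmf (\<lambda>x. ((A x, F x), J x)) p) = ent (map_pmf (\<lambda>x. (A x, F x)) p)"
    by (rule ent_map_cong[OF fin]; auto dest: J)+
  ultimately show ?thesis using fano by simp
qed

text \<open>Submodularity of \<open>A\<close> and \<open>B\<close> given \<open>(K, F)\<close>
  bounds \<open>H(A, B)\<close> by \<open>H(A, K, F) + H(B, K, F) - H(K, F)\<close>. Removing
  \<open>K\<close> from the first two terms costs \<open>\<delta>\<close> each, and
  \<open>H(K, F)\<close> is traded for \<open>H(K)\<close> through the leakage
  \<open>mutinf p K F\<close>.\<close>

lemma ent_key_le:
  assumes fin: "finite (set_pmf p)"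
    and F: "\<And>x y. A x = A y \<Longrightarrow> B x = B y \<Longrightarrow> F x = F y"
    and A: "ent (map_pmf (\<lambda>x. (K x, A x, F x)) p) \<le> ent (map_pmf (\<lambda>x. (A x, F x)) p) + \<delta>"
    and B: "ent (map_pmf (\<lambda>x. (K x, B x, F x)) p) \<le> ent (map_pmf (\<lambda>x. (B x, F x)) p) + \<delta>"
    and AB: "ent (map_pmf (\<lambda>x. (A x, F x)) p) + ent (map_pmf (\<lambda>x. (B x, F x)) p) - ent (map_pmf F p)
      \<le> ent (map_pmf A p) + ent (map_pmf B p)"
  shows "ent (map_pmf K p) \<le> mutinf p K F
    + (ent (map_pmf A p) + ent (map_pmf B p) - ent (map_pmf (\<lambda>x. (A x, B x)) p)) + 2 * \<delta>"
proof -
  have "ent (map_pmf (\<lambda>x. (A x, B x, K x, F x)) p) + ent (map_pmf (\<lambda>x. (K x, F x)) p)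
     \<le> ent (map_pmf (\<lambda>x. (A x, K x, F x)) p) + ent (map_pmf (\<lambda>x. (B x, K x, F x)) p)"
    by (rule ent_submodular[OF fin])
  moreover have "ent (map_pmf (\<lambda>x. (A x, K x, F x)) p) = ent (map_pmf (\<lambda>x. (K x, A x, F x)) p)"
    "ent (map_pmf (\<lambda>x. (B x, K x, F x)) p) = ent (map_pmf (\<lambda>x. (K x, B x, F x)) p)"
    by (rule ent_map_cong[OF fin]; auto)+
  moreover have "ent (map_pmf (\<lambda>x. (A x, B x)) p) \<le> ent (map_pmf (\<lambda>x. (A x, B x, K x, F x)) p)"
    by (rule ent_map_mono[OF fin]) auto
  ultimately show ?thesis using A B AB unfolding mutinf_def by simp
qed

text \<open>Only the decoders at \<open>i\<close> and \<open>j\<close> enter. For each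
  \<open>\<epsilon>\<close> a single large blocklength suffices; the single-letter bound appears
  after dividing by \<open>n\<close> and letting \<open>\<epsilon>\<close> tend to 0.\<close>

lemma sk_rate_le_mutual_information:
  fixes P :: "('a::finite \<times> 'b::finite \<times> 'c::finite) pmf"
  assumes ij: "i \<in> terms" "j \<in> terms" and ach: "sk_achievable P {i, j} R"
  shows "R \<le> HA P {i} + HA P {j} - HA P {i, j}"
proof -
  define I where "I = HA P {i} + HA P {j} - HA P {i, j}"
  define C where "C = CARD('a \<times> 'b \<times> 'c)"
  have C: "C \<ge> 1" unfolding C_def by (simp add: Suc_le_eq)
  obtain ps and K :: "nat \<Rightarrow> ('a \<times> 'b \<times> 'c) list \<Rightarrow> nat"
    where valid: "\<And>n. valid_protocol {i, j} (ps n)" and cr: "is_CR P ps K"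
      and sec: "\<And>\<epsilon>. \<epsilon> > 0 \<Longrightarrow> \<forall>\<^sub>F n in sequentially. mutinf (iid P n) (K n) (run (ps n)) \<le> \<epsilon> \<and>
            ent (map_pmf (K n) (iid P n)) / real n \<ge> R - \<epsilon>"
    using ach unfolding sk_achievable_def by blast
  \<comment> \<open>One \<open>\<epsilon>\<close> comes from the rate condition, one from the
    leakage, and \<open>2 * (\<epsilon> + \<epsilon> * log 2 C)\<close> from the Fano terms
    \<open>2 * \<delta>\<close> per symbol.\<close>
  have main: "R \<le> I + \<epsilon> * (4 + 2 * log 2 C)" if \<epsilon>: "0 < \<epsilon>" "\<epsilon> < 1" for \<epsilon>
  proof -
    \<comment> \<open>The bound on \<open>n\<close> gives \<open>1 \<le> \<epsilon> * n\<close>, so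
      the constant bit in Fano's inequality is absorbed into the linear error.\<close>
    have "\<forall>\<^sub>F n in sequentially. n > nat \<lceil>1 / \<epsilon>\<rceil> \<and>
       (mutinf (iid P n) (K n) (run (ps n)) \<le> \<epsilon> \<and> ent (map_pmf (K n) (iid P n)) / real n \<ge> R - \<epsilon>) \<and>
       (\<exists>Jl :: nat \<Rightarrow> ('a \<times> 'b \<times> 'c) list \<Rightarrow> nat.
             (\<forall>i\<in>terms. \<forall>w w'. local_eq i w w' \<and> run (ps n) w = run (ps n) w' \<longrightarrow> Jl i w = Jl i w') \<and>
             measure_pmf.prob (iid P n) {w. \<forall>i\<in>terms. Jl i w = K n w} \<ge> 1 - \<epsilon>)"
      using cr \<epsilon> unfolding is_CR_def by (intro eventually_conj[OF eventually_gt_at_top eventually_conj[OF sec[OF \<epsilon>(1)]]]) blast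
    then obtain n Jl where n: "n > nat \<lceil>1 / \<epsilon>\<rceil>"
      and I: "mutinf (iid P n) (K n) (run (ps n)) \<le> \<epsilon>"
      and H: "ent (map_pmf (K n) (iid P n)) / real n \<ge> R - \<epsilon>"
      and loc: "\<And>l w w'. l \<in> terms \<Longrightarrow> local_eq l w w' \<Longrightarrow> run (ps n) w = run (ps n) w' \<Longrightarrow> Jl l w = (Jl l w' :: nat)"
      and pr: "measure_pmf.prob (iid P n) {w. \<forall>l\<in>terms. Jl l w = K n w} \<ge> 1 - \<epsilon>"
      using eventually_happens'[OF sequentially_bot] by blast
    have "1 / \<epsilon> < real n"
      using n real_nat_ceiling_ge[of "1 / \<epsilon>"] by linarith
    then have npos: "real n > 0" and n\<epsilon>: "1 \<le> \<epsilon> * n"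
      using n \<epsilon> by (auto simp: field_simps)
    let ?p = "iid P n" let ?F = "run (ps n)"
    have fin: "finite (set_pmf ?p)" by (simp add: finite_set_iid)
    \<comment> \<open>The key takes arbitrary natural values, but as a function of the realization
      it has at most \<open>C ^ n\<close> of them.\<close>
    define \<delta> where "\<delta> = 1 + \<epsilon> * log 2 (C ^ n)"
    have card: "card (K n ` set_pmf ?p) \<le> C ^ n"
    proof -
      have "card (K n ` set_pmf ?p) \<le> card (set_pmf ?p)" by (rule card_image_le[OF fin])
      also have "\<dots> \<le> card {w :: ('a \<times> 'b \<times> 'c) list. set w \<subseteq> UNIV \<and> length w = n}"
        by (intro card_mono finite_lists_length_eq) (auto simp: set_iid)
      also have "\<dots> = C ^ n" unfolding C_def by (rule card_lists_length_eq) simp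
      finally show ?thesis .
    qed
    have fano: "ent (map_pmf (\<lambda>w. (K n w, map (proj {l}) w, ?F w)) ?p) \<le> ent (map_pmf (\<lambda>w. (map (proj {l}) w, ?F w)) ?p) + \<delta>"
      if l: "l \<in> terms" for l
    proof (rule ent_common_randomness_le[OF fin])
      show "map (proj {l}) x = map (proj {l}) y \<Longrightarrow> ?F x = ?F y \<Longrightarrow> Jl l x = Jl l y" for x y :: "('a \<times> 'b \<times> 'c) list"
        using loc[of l x y] l by (simp add: local_eq_iff)
      have "1 - \<epsilon> \<le> measure_pmf.prob ?p {w. Jl l w = K n w}"
        using pr by (rule order_trans) (use l in \<open>auto intro!: measure_pmf.finite_measure_mono\<close>)
      from fano[OF fin card this]
      show "ent (map_pmf (\<lambda>x. (K n x, Jl l x)) ?p) \<le> ent (map_pmf (Jl l) ?p) + \<delta>"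
        by (simp add: \<delta>_def)
    qed
    have "ent (map_pmf (K n) ?p) \<le> mutinf ?p (K n) ?F
      + (ent (map_pmf (map (proj {i})) ?p) + ent (map_pmf (map (proj {j})) ?p) - ent (map_pmf (\<lambda>w. (map (proj {i}) w, map (proj {j}) w)) ?p)) + 2 * \<delta>"
    proof (rule ent_key_le[OF fin])
      show "?F x = ?F y" if "map (proj {i}) x = map (proj {i}) y" "map (proj {j}) x = map (proj {j}) y" for x y
        by (rule local_eq_run[OF valid]) (use that ij in \<open>auto simp: local_eq_iff\<close>)
    qed (use fano ij ent_interactive_communication[OF fin ij valid] in auto)
    also have "ent (map_pmf (\<lambda>w. (map (proj {i}) w, map (proj {j}) w)) ?p) = ent (map_pmf (map (proj ({i} \<union> {j}))) ?p)"
      by (rule ent_map_cong[OF fin]) (use map_proj_Un_eq_iff[of "{i}" "{j}"] in auto)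
    finally have "ent (map_pmf (K n) ?p) \<le> \<epsilon> + n * I + 2 * \<delta>"
      using I unfolding ent_map_proj_iid insert_is_Un[of i "{j}", symmetric] I_def ring_distribs by simp
    moreover have "n * (R - \<epsilon>) \<le> ent (map_pmf (K n) ?p)"
      using H npos by (simp add: field_simps)
    moreover have "\<delta> = 1 + n * (\<epsilon> * log 2 C)"
      using C by (simp add: \<delta>_def log_nat_power mult_ac)
    moreover have "\<epsilon> \<le> \<epsilon> * n" using n \<epsilon> by (simp add: Suc_le_eq)
    ultimately have "n * (R - \<epsilon>) \<le> \<epsilon> * n + n * I + 2 * (\<epsilon> * n + n * (\<epsilon> * log 2 C))"
      using n\<epsilon> by (simp add: algebra_simps)
    also have "\<dots> = n * (\<epsilon> + I + 2 * (\<epsilon> + \<epsilon> * log 2 C))" by (simp add: algebra_simps)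
    finally have "R - \<epsilon> \<le> \<epsilon> + I + 2 * (\<epsilon> + \<epsilon> * log 2 C)" using npos by simp
    then show ?thesis by (simp add: algebra_simps)
  qed
  have "((\<lambda>\<epsilon>. I + \<epsilon> * (4 + 2 * log 2 C)) \<longlongrightarrow> I + 0 * (4 + 2 * log 2 C)) (at_right 0)"
    by (intro tendsto_intros)
  moreover have "\<forall>\<^sub>F \<epsilon> in at_right 0. R \<le> I + \<epsilon> * (4 + 2 * log 2 C)"
    using eventually_at_right_real[of 0 1] main by (auto elim!: eventually_mono)
  ultimately show ?thesis unfolding I_def[symmetric]
    by (intro tendsto_lowerbound) auto
qed

section \<open>Random hashing\<close>

lemma prob_eq_expec: "measure_pmf.prob p A = expec p (indicator A)"
  by simp

lemma prob_Collect_eq_expec: "measure_pmf.prob p {x. R x} = expec p (\<lambda>x. of_bool (R x))"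
  unfolding prob_eq_expec by (rule Bochner_Integration.integral_cong) (auto simp: indicator_def)

lemma prob_pair_times:
  assumes "finite (set_pmf p)" "finite (set_pmf q)"
  shows "measure_pmf.prob (pair_pmf p q) (A \<times> B) = measure_pmf.prob p A * measure_pmf.prob q B"
  unfolding prob_eq_expec expec_pair[OF assms] by (simp add: indicator_times)

lemma expec_prob_swap:
  assumes "finite (set_pmf p)" "finite (set_pmf q)"
  shows "expec p (\<lambda>x. measure_pmf.prob q {y. R x y}) = expec q (\<lambda>y. measure_pmf.prob p {x. R x y})"
  unfolding prob_Collect_eq_expec by (rule expec_swap[OF assms])

text \<open>Values on \<open>A\<close> are drawn independently and uniformly below \<open>L\<close>.
  For \<open>x \<noteq> y\<close> the value at \<open>x\<close> is independent of the value at
  \<open>y\<close>, so it hits it with probability at most \<open>1 / L\<close>.\<close>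

lemma exists_universal_hash:
  assumes fin: "finite A" and L: "0 < L"
  shows "\<exists>S :: ('x \<Rightarrow> nat) pmf. finite (set_pmf S) \<and> (\<forall>f\<in>set_pmf S. \<forall>x. f x < L) \<and>
    (\<forall>x\<in>A. \<forall>y\<in>A. x \<noteq> y \<longrightarrow> measure_pmf.prob S {f. f x = f y} \<le> 1 / L)"
proof -
  define U where "U = pmf_of_set {..<L}"
  have set_U: "set_pmf U = {..<L}" unfolding U_def using L by (subst set_pmf_of_set) auto
  \<comment> \<open>Outside \<open>A\<close> every function takes the default value 0, which is
    below \<open>L\<close> because \<open>L\<close> is positive.\<close>
  define S where "S = Pi_pmf A 0 (\<lambda>_. U)"
  have set_S: "set_pmf S = PiE_dflt A 0 (\<lambda>_. {..<L})"
    unfolding S_def by (subst set_Pi_pmf[OF fin]) (simp add: set_U o_def)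
  have "measure_pmf.prob S {f. f x = f y} \<le> 1 / L" if x: "x \<in> A" and y: "y \<in> A" and ne: "x \<noteq> y" for x y
  proof -
    let ?B = "A - {x}"
    let ?S = "Pi_pmf ?B 0 (\<lambda>_. U)"
    have finS: "finite (set_pmf ?S)"
      using fin by (subst set_Pi_pmf) (auto simp: set_U o_def intro!: finite_PiE_dflt)
    have finU: "finite (set_pmf U)" by (simp add: set_U)
    have "S = map_pmf (\<lambda>(v, f). f(x := v)) (pair_pmf U ?S)"
      unfolding S_def using Pi_pmf_insert[of ?B x 0 "\<lambda>_. U"] fin x by (simp add: insert_absorb)
    then have "measure_pmf.prob S {f. f x = f y} = measure_pmf.prob (pair_pmf U ?S) {(v, f). v = f y}"
      using ne by (simp add: vimage_def case_prod_unfold)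
    also have "\<dots> = expec U (\<lambda>v. measure_pmf.prob ?S {f. v = f y})"
      unfolding prob_Collect_eq_expec expec_pair[OF finU finS] by simp
    also have "\<dots> = expec ?S (\<lambda>f. measure_pmf.prob U {v. v = f y})"
      by (rule expec_prob_swap[OF finU finS])
    also have "\<dots> \<le> expec ?S (\<lambda>f. 1 / L)"
    proof (intro expec_mono finS)
      fix f
      have "pmf U (f y) \<le> 1 / L" using L unfolding U_def by (subst pmf_of_set) (auto simp: indicator_def)
      then show "measure_pmf.prob U {v. v = f y} \<le> 1 / L" by (simp add: measure_pmf_single)
    qed
    finally show ?thesis by simp
  qed
  moreover have "finite (set_pmf S)" unfolding set_S using fin by (intro finite_PiE_dflt) auto
  moreover have "f x < L" if "f \<in> set_pmf S" for f x
    using that L unfolding set_S PiE_dflt_def by (cases "x \<in> A") auto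
  ultimately show ?thesis by (intro exI[of _ S] conjI ballI allI impI)
qed

text \<open>At most \<open>p\<^sub>r(w) / p\<^sub>q(w)\<close> values of \<open>q\<close> compatible with \<open>r w\<close> are as likely as \<open>q w\<close>,
  and each of them collides with probability at most \<open>1 / L\<close>.\<close>
lemma expec_collision_error_le:
  assumes finp: "finite (set_pmf p)" and finS: "finite (set_pmf S)" and L: "(0::real) < L"
    and t: "0 < t" "t \<le> (1::real)"
    and r: "\<And>x y. q x = q y \<Longrightarrow> r x = r y"
    and C_cong: "\<And>s w x y. q x = q y \<Longrightarrow> C s w x = C s w y"
    and C: "\<And>w x. w \<in> set_pmf p \<Longrightarrow> x \<in> set_pmf p \<Longrightarrow> measure_pmf.prob S {s. C s w x} \<le> 1 / L"
  shows "expec S (\<lambda>s. measure_pmf.prob p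
      {w. \<exists>x\<in>set_pmf p. r x = r w \<and> pmf (map_pmf q p) (q w) \<le> pmf (map_pmf q p) (q x) \<and> C s w x})
    \<le> expec p (\<lambda>w. (pmf (map_pmf r p) (r w) / pmf (map_pmf q p) (q w) / L) powr t)"
  unfolding expec_prob_swap[OF finS finp]
proof (intro expec_mono finp)
  fix w assume w: "w \<in> set_pmf p"
  let ?pq = "\<lambda>x. pmf (map_pmf q p) (q x)"
  let ?y = "pmf (map_pmf r p) (r w) / ?pq w / L"
  define D where "D = {x \<in> set_pmf p. r x = r w \<and> ?pq w \<le> ?pq x}"
  have finD: "finite D" unfolding D_def using finp by simp
  have pq: "0 < ?pq w" by (rule pmf_map_pos[OF w])
  let ?pr = "measure_pmf.prob S {s. \<exists>x\<in>set_pmf p. r x = r w \<and> ?pq w \<le> ?pq x \<and> C s w x}"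
  have "card (q ` D) * ?pq w = (\<Sum>v\<in>q ` D. ?pq w)" by simp
  also have "\<dots> \<le> (\<Sum>v\<in>q ` D. pmf (map_pmf q p) v)"
    by (intro sum_mono) (auto simp: D_def)
  also have "\<dots> = measure_pmf.prob p (q -` (q ` D))"
    using finD by (subst measure_measure_pmf_finite[symmetric]) auto
  also have "\<dots> \<le> pmf (map_pmf r p) (r w)"
    unfolding pmf_map by (intro measure_pmf.finite_measure_mono) (auto simp: D_def dest: r)
  finally have card: "card (q ` D) \<le> pmf (map_pmf r p) (r w) / ?pq w"
    using pq by (simp add: field_simps)
  \<comment> \<open>The union bound runs over values of \<open>q\<close>, not over realizations: the
    collision event depends on \<open>x\<close> only through \<open>q x\<close>.\<close>
  have "?pr \<le> measure_pmf.prob S (\<Union>v\<in>q ` D. {s. \<exists>x\<in>D. q x = v \<and> C s w x})"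
    by (intro measure_pmf.finite_measure_mono) (auto simp: D_def)
  also have "\<dots> \<le> (\<Sum>v\<in>q ` D. measure_pmf.prob S {s. \<exists>x\<in>D. q x = v \<and> C s w x})"
    using finD by (intro measure_UNION_le) auto
  also have "\<dots> \<le> (\<Sum>v\<in>q ` D. 1 / L)"
  proof (intro sum_mono)
    fix v assume "v \<in> q ` D"
    then obtain x where x: "x \<in> D" "v = q x" by auto
    then have "measure_pmf.prob S {s. \<exists>x\<in>D. q x = v \<and> C s w x} \<le> measure_pmf.prob S {s. C s w x}"
    proof (intro measure_pmf.finite_measure_mono subsetI CollectI)
      fix s assume "s \<in> {s. \<exists>x\<in>D. q x = v \<and> C s w x}"
      then obtain y where "q y = v" "C s w y" by auto
      then show "C s w x" using C_cong[of y x s w] x(2) by simp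
    qed simp
    also have "\<dots> \<le> 1 / L" using x w by (intro C) (auto simp: D_def)
    finally show "measure_pmf.prob S {s. \<exists>x\<in>D. q x = v \<and> C s w x} \<le> 1 / L" .
  qed
  also have "\<dots> = card (q ` D) / L" by simp
  also have "\<dots> \<le> ?y" using card L by (intro divide_right_mono) auto
  finally have le: "?pr \<le> ?y" .
  \<comment> \<open>The probability is at most both \<open>?y\<close> and 1, and the smaller of
    these is at most \<open>?y powr t\<close> for \<open>0 < t \<le> 1\<close>.\<close>
  show "?pr \<le> ?y powr t"
  proof (cases "?y \<le> 1")
    case True
    have "0 \<le> ?y" using L by simp
    then have "?y \<le> ?y powr t" using True t powr_mono'[of t 1 ?y] by (simp only: powr_one order_less_imp_le)
    with le show ?thesis by simp
  next
    case False
    then have "1 \<le> ?y powr t" using t by (intro ge_one_powr_ge_zero) auto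
    with measure_pmf.prob_le_1[of S] show ?thesis by (rule order_trans)
  qed
qed

text \<open>Jensen's inequality for the logarithm, by applying the tangent bound at 1 to
  \<open>Z\<close> divided by its mean.\<close>

lemma expec_log_le:
  assumes fin: "finite (set_pmf p)" and pos: "\<And>x. x \<in> set_pmf p \<Longrightarrow> 0 < Z x"
  shows "expec p (\<lambda>x. log 2 (Z x)) \<le> log 2 (expec p Z)"
proof -
  have m: "0 < expec p Z" unfolding expec_eq_sum[OF fin]
    using fin pos set_pmf_not_empty[of p] by (intro sum_pos mult_pos_pos) (auto simp: pmf_positive)
  have "expec p (\<lambda>x. log 2 (Z x)) - log 2 (expec p Z) = expec p (\<lambda>x. log 2 (Z x / expec p Z))"
  proof -
    have "expec p (\<lambda>x. log 2 (Z x) - log 2 (expec p Z)) = expec p (\<lambda>x. log 2 (Z x / expec p Z))"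
      by (intro expec_cong fin) (use pos m in \<open>simp add: log_divide less_imp_neq[symmetric]\<close>)
    then show ?thesis by (simp add: expec_diff[OF fin])
  qed
  also have "\<dots> \<le> expec p (\<lambda>x. (Z x / expec p Z - 1) / ln 2)"
    by (intro expec_mono fin log2_le_minus_one divide_pos_pos pos m)
  also have "\<dots> = 0"
    using m by (simp add: expec_diff[OF fin])
  finally show ?thesis by simp
qed

text \<open>Reduces near-uniformity of a random hash to collision probabilities. The gap is the mean
  logarithm of \<open>N\<close> times the mass of the hash cell of \<open>w\<close>; Jensen moves
  the average over seeds inside the logarithm.\<close>

lemma expec_entropy_gap_le:
  fixes N :: real
  assumes finp: "finite (set_pmf p)" and finS: "finite (set_pmf S)" and N: "0 < N"
  shows "expec S (\<lambda>s. log 2 N - ent (map_pmf (h s) p))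
    \<le> expec p (\<lambda>w. log 2 (N * expec p (\<lambda>x. measure_pmf.prob S {s. h s x = h s w})))"
proof -
  let ?Z = "\<lambda>w s. pmf (map_pmf (h s) p) (h s w)"
  have "log 2 N - ent (map_pmf (h s) p) = expec p (\<lambda>w. log 2 (N * ?Z w s))" for s
  proof -
    have "expec p (\<lambda>w. log 2 (N * ?Z w s)) = expec p (\<lambda>w. log 2 N - - log 2 (?Z w s))"
      by (intro expec_cong finp) (use N pmf_map_pos[of _ p "h s"] in \<open>simp add: log_mult less_imp_neq[symmetric]\<close>)
    then show ?thesis unfolding expec_diff[OF finp] ent_map_eq_expec[OF finp] by simp
  qed
  then have "expec S (\<lambda>s. log 2 N - ent (map_pmf (h s) p)) = expec p (\<lambda>w. expec S (\<lambda>s. log 2 (N * ?Z w s)))"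
    by (simp add: expec_swap[OF finS finp])
  also have "\<dots> \<le> expec p (\<lambda>w. log 2 (expec S (\<lambda>s. N * ?Z w s)))"
    by (intro expec_mono finp expec_log_le finS mult_pos_pos N pmf_map_pos)
  also have "\<dots> = expec p (\<lambda>w. log 2 (N * expec p (\<lambda>x. measure_pmf.prob S {s. h s x = h s w})))"
    unfolding expec_prob_swap[OF finp finS] by (simp add: pmf_map vimage_def)
  finally show ?thesis .
qed

text \<open>Since \<open>u \<le> u powr t\<close> on the unit interval, the fractions
  \<open>1 / (1 + y)\<close> and \<open>y / (1 + y)\<close> yield
  \<open>(1 + y) powr t \<le> 1 + y powr t\<close>; then \<open>ln (1 + z) \<le> z\<close>. This
  turns entropy gaps into the same kind of moments as decoding errors.\<close>

lemma log2_one_plus_le: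
  assumes y: "0 \<le> y" and t: "0 < t" "t \<le> (1::real)"
  shows "log 2 (1 + y) \<le> y powr t / (t * ln 2)"
proof -
  have "1 / (1 + y) \<le> (1 / (1 + y)) powr t" "y / (1 + y) \<le> (y / (1 + y)) powr t"
    using powr_mono'[of t 1 "1 / (1 + y)"] powr_mono'[of t 1 "y / (1 + y)"] y t by simp_all
  then have "1 / (1 + y) + y / (1 + y) \<le> (1 + y powr t) / (1 + y) powr t"
    using y by (simp add: powr_divide add_divide_distrib)
  then have "(1 + y) powr t \<le> 1 + y powr t"
    using y by (simp add: add_divide_distrib[symmetric] field_simps)
  then have "ln ((1 + y) powr t) \<le> ln (1 + y powr t)"
    using y by (subst ln_le_cancel_iff) (auto simp: add_pos_nonneg)
  also have "\<dots> \<le> y powr t" by (rule ln_add_one_self_le_self) simp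
  finally have "t * ln (1 + y) \<le> y powr t" using y by (simp add: ln_powr)
  then show ?thesis using t by (simp add: log_def field_simps)
qed

text \<open>Maximum a posteriori decoding: among the realizations in \<open>W\<close> compatible
  with the observation \<open>X\<close> and transcript \<open>F\<close>, take one of largest
  \<open>q\<close> and output its key.\<close>

lemma exists_map_decoder:
  fixes q :: "'w \<Rightarrow> real"
  assumes fin: "finite W"
  shows "\<exists>J. (\<forall>w w'. X w = X w' \<and> F w = F w' \<longrightarrow> J w = J w') \<and>
    (\<forall>w\<in>W. (\<forall>x\<in>W. X x = X w \<longrightarrow> F x = F w \<longrightarrow> q w \<le> q x \<longrightarrow> K x = K w) \<longrightarrow> J w = K w)"
proof -
  define D where "D w = {x \<in> W. X x = X w \<and> F x = F w}" for w
  \<comment> \<open>The choice depends on \<open>w\<close> only through the set \<open>D w\<close>,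
    hence only on what the terminal knows.\<close>
  define J where "J w = K (SOME x. x \<in> D w \<and> (\<forall>y\<in>D w. q y \<le> q x))" for w
  have "J w = J w'" if "X w = X w' \<and> F w = F w'" for w w'
  proof -
    have "D w = D w'" using that by (simp add: D_def)
    then show ?thesis by (simp add: J_def)
  qed
  moreover have "J w = K w" if w: "w \<in> W"
    and uniq: "\<forall>x\<in>W. X x = X w \<longrightarrow> F x = F w \<longrightarrow> q w \<le> q x \<longrightarrow> K x = K w" for w
  proof -
    have wD: "w \<in> D w" using w by (simp add: D_def)
    have finD: "finite (D w)" using fin by (simp add: D_def)
    have "Max (q ` D w) \<in> q ` D w" using finD wD by (intro Max_in) auto
    then obtain x where "x \<in> D w" "q x = Max (q ` D w)" by auto
    then have "x \<in> D w \<and> (\<forall>y\<in>D w. q y \<le> q x)" using finD by simp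
    then have ex: "\<exists>x. x \<in> D w \<and> (\<forall>y\<in>D w. q y \<le> q x)" by blast
    define x where "x = (SOME x. x \<in> D w \<and> (\<forall>y\<in>D w. q y \<le> q x))"
    have "x \<in> D w" "q w \<le> q x" using someI_ex[OF ex] wD unfolding x_def by blast+
    then show ?thesis using uniq unfolding J_def x_def[symmetric] by (simp add: D_def)
  qed
  ultimately show ?thesis by (intro exI[of _ J] conjI allI impI ballI)
qed

text \<open>Both sides equal 1 at \<open>t = 0\<close>, and the hypothesis says that their
  difference \<open>G\<close> has negative derivative there.\<close>

lemma eventually_expec_powr_less:
  assumes fin: "finite (set_pmf P)" and pos: "\<And>x. x \<in> set_pmf P \<Longrightarrow> 0 < \<phi> x"
    and less: "expec P (\<lambda>x. log 2 (\<phi> x)) < r"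
  shows "\<forall>\<^sub>F t in at_right 0. expec P (\<lambda>x. \<phi> x powr t) < 2 powr (r * t)"
proof -
  define G where "G t = (\<Sum>x\<in>set_pmf P. pmf P x * exp (t * ln (\<phi> x))) - exp (r * t * ln 2)" for t :: real
  have "(G has_real_derivative (\<Sum>x\<in>set_pmf P. pmf P x * ln (\<phi> x)) - r * ln 2) (at 0)"
    unfolding G_def by (auto intro!: derivative_eq_intros simp: mult_ac)
  moreover have "(\<Sum>x\<in>set_pmf P. pmf P x * ln (\<phi> x)) = expec P (\<lambda>x. log 2 (\<phi> x)) * ln 2"
    unfolding expec_eq_sum[OF fin] by (simp add: log_def sum_distrib_right)
  ultimately have "\<exists>d>0. \<forall>h>0. h < d \<longrightarrow> G (0 + h) < G 0"
    using less by (intro DERIV_neg_dec_right) auto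
  then obtain d where d: "d > 0" "\<And>h. 0 < h \<Longrightarrow> h < d \<Longrightarrow> G h < G 0" by auto
  have G0: "G 0 = 0" using sum_pmf_eq_1[OF fin order_refl] by (simp add: G_def)
  have "expec P (\<lambda>x. \<phi> x powr h) < 2 powr (r * h)" if "0 < h" "h < d" for h
  proof -
    have "expec P (\<lambda>x. \<phi> x powr h) = (\<Sum>x\<in>set_pmf P. pmf P x * exp (h * ln (\<phi> x)))"
      unfolding expec_eq_sum[OF fin] by (intro sum.cong) (auto simp: powr_def dest: pos)
    then show ?thesis using d(2)[OF that] G0 by (simp add: G_def powr_def)
  qed
  then show ?thesis using d(1) by (auto simp: eventually_at_right_field)
qed

text \<open>By independence the moment is exactly the \<open>n\<close>-th power of a fixed ratio,
  which the hypothesis makes less than 1.\<close>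

lemma expec_iid_powr_tendsto_0:
  fixes \<phi> :: "'x \<Rightarrow> real" and r t :: real
  assumes fin: "finite (set_pmf P)" and pos: "\<And>x. x \<in> set_pmf P \<Longrightarrow> 0 < \<phi> x"
    and less: "expec P (\<lambda>x. \<phi> x powr t) < 2 powr (r * t)"
  shows "(\<lambda>n. expec (iid P n) (\<lambda>w. (prod_list (map \<phi> w) / 2 powr (n * r)) powr t)) \<longlonglongrightarrow> 0"
proof -
  define c where "c = expec P (\<lambda>x. \<phi> x powr t)"
  have powr: "prod_list (map \<phi> w) powr t = prod_list (map (\<lambda>x. \<phi> x powr t) w)" if "set w \<subseteq> set_pmf P" for w
    using that
  proof (induction w)
    case (Cons x w)
    then have "0 < \<phi> x" "0 < prod_list (map \<phi> w)" by (auto intro!: pos prod_list_map_pos)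
    with Cons show ?case by (simp add: powr_mult)
  qed simp
  have "expec (iid P n) (\<lambda>w. (prod_list (map \<phi> w) / 2 powr (n * r)) powr t) = (c / 2 powr (r * t)) ^ n" for n
  proof -
    have "expec (iid P n) (\<lambda>w. (prod_list (map \<phi> w) / 2 powr (n * r)) powr t)
      = expec (iid P n) (\<lambda>w. prod_list (map (\<lambda>x. \<phi> x powr t) w) / (2 powr (r * t)) ^ n)"
    proof (intro expec_cong finite_set_iid fin)
      fix w assume "w \<in> set_pmf (iid P n)"
      then have w: "set w \<subseteq> set_pmf P" by (simp add: set_iid)
      then have "0 < prod_list (map \<phi> w)" by (auto intro!: pos prod_list_map_pos)
      moreover have "(2 powr (r * t)) ^ n = (2 powr (n * r)) powr t"
        by (simp add: powr_powr powr_realpow[symmetric] mult_ac)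
      ultimately show "(prod_list (map \<phi> w) / 2 powr (n * r)) powr t = prod_list (map (\<lambda>x. \<phi> x powr t) w) / (2 powr (r * t)) ^ n"
        by (simp add: powr_divide powr[OF w])
    qed
    then show ?thesis by (simp add: expec_iid_prod_list[OF fin] c_def power_divide)
  qed
  moreover have "(\<lambda>n. (c / 2 powr (r * t)) ^ n) \<longlonglongrightarrow> 0"
  proof (rule LIMSEQ_realpow_zero)
    show "0 \<le> c / 2 powr (r * t)" unfolding c_def expec_eq_sum[OF fin] by (simp add: sum_nonneg)
  qed (use less in \<open>simp add: c_def\<close>)
  ultimately show ?thesis by simp
qed

section \<open>Random binning codes\<close>

text \<open>Evaluated at a realization rather than at a value of \<open>f\<close>, so that its
  negative logarithm is the information content whose mean is the entropy of
  \<open>f\<close>.\<close>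

definition marginal :: "'w pmf \<Rightarrow> ('w \<Rightarrow> 'v) \<Rightarrow> 'w \<Rightarrow> real" where
  "marginal p f w = pmf (map_pmf f p) (f w)"

lemma marginal_nonneg [simp]: "0 \<le> marginal p f w"
  by (simp add: marginal_def)

lemma marginal_pos: "w \<in> set_pmf p \<Longrightarrow> 0 < marginal p f w"
  unfolding marginal_def by (rule pmf_map_pos)

lemma marginal_eq_expec: "marginal p f w = expec p (\<lambda>x. of_bool (f x = f w))"
  unfolding marginal_def pmf_map prob_Collect_eq_expec[symmetric] by (simp add: vimage_def)

lemma prob_eq_ge:
  assumes "\<And>w. w \<in> set_pmf p \<Longrightarrow> w \<notin> B \<Longrightarrow> J w = K w"
  shows "1 - measure_pmf.prob p B \<le> measure_pmf.prob p {w. J w = K w}"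
proof -
  have "measure_pmf.prob p ({w. J w = K w} \<union> B) = 1"
    using assms by (subst measure_pmf.prob_eq_1) (auto simp: AE_measure_pmf_iff)
  then have "1 = measure_pmf.prob p ({w. J w = K w} \<union> B)" by simp
  also have "\<dots> \<le> measure_pmf.prob p {w. J w = K w} + measure_pmf.prob p B"
    by (intro measure_Un_le) auto
  finally show ?thesis by simp
qed

lemma exists_reliable_decoder:
  fixes q :: "'w \<Rightarrow> real"
  assumes fin: "finite (set_pmf p)"
    and E: "\<And>w x. \<lbrakk>w \<in> set_pmf p; x \<in> set_pmf p; X x = X w; F x = F w; q w \<le> q x; K x \<noteq> K w\<rbrakk> \<Longrightarrow> w \<in> E"
    and prob: "measure_pmf.prob p E \<le> B"
  shows "\<exists>J. (\<forall>w w'. X w = X w' \<and> F w = F w' \<longrightarrow> J w = J w') \<and> 1 - B \<le> measure_pmf.prob p {w. J w = K w}"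
proof -
  from exists_map_decoder[OF fin, of X F q K]
  obtain J where J: "\<forall>w w'. X w = X w' \<and> F w = F w' \<longrightarrow> J w = J w'"
    and K: "\<forall>w\<in>set_pmf p. (\<forall>x\<in>set_pmf p. X x = X w \<longrightarrow> F x = F w \<longrightarrow> q w \<le> q x \<longrightarrow> K x = K w) \<longrightarrow> J w = K w"
    by (elim exE conjE)
  have "J w = K w" if w: "w \<in> set_pmf p" "w \<notin> E" for w
  proof (rule K[rule_format, OF w(1)], rule ccontr)
    fix x assume "x \<in> set_pmf p" "X x = X w" "F x = F w" "q w \<le> q x" "K x \<noteq> K w"
    from E[OF w(1) this] w(2) show False by simp
  qed
  then have "1 - measure_pmf.prob p E \<le> measure_pmf.prob p {w. J w = K w}" by (rule prob_eq_ge)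
  with prob have "1 - B \<le> measure_pmf.prob p {w. J w = K w}" by simp
  with J show ?thesis by (intro exI[of _ J] conjI)
qed

text \<open>A one-shot code: \<open>f1\<close> and \<open>f2\<close> bin the two transmitted
  observations, and \<open>g\<close> hashes the pair into the key. In \<open>B\<close>, two terms
  bound the errors at i and j, three those at k (\<open>Xi\<close> wrong, \<open>Xj\<close> wrong,
  both wrong), and the last group bounds the entropy gap. All bound averages over one random seed,
  so one seed serves every requirement.\<close>

lemma exists_random_binning_code:
  fixes p :: "'w pmf" and Xi :: "'w \<Rightarrow> 'x" and Xj :: "'w \<Rightarrow> 'y" and Xk :: "'w \<Rightarrow> 'z"
    and L1 L2 M :: nat and t :: real
  assumes finp: "finite (set_pmf p)" and L: "0 < L1" "0 < L2" "0 < M" and t: "0 < t" "t \<le> 1"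
  defines "ij \<equiv> \<lambda>w. (Xi w, Xj w)" and "ik \<equiv> \<lambda>w. (Xi w, Xk w)" and "jk \<equiv> \<lambda>w. (Xj w, Xk w)"
    and "ijk \<equiv> \<lambda>w. (Xi w, Xj w, Xk w)"
  defines "B \<equiv> expec p (\<lambda>w. (marginal p Xi w / marginal p ij w / L2) powr t)
      + expec p (\<lambda>w. (marginal p Xj w / marginal p ij w / L1) powr t)
      + expec p (\<lambda>w. (marginal p jk w / marginal p ijk w / L1) powr t)
      + expec p (\<lambda>w. (marginal p ik w / marginal p ijk w / L2) powr t)
      + expec p (\<lambda>w. (marginal p Xk w / marginal p ijk w / (L1 * L2)) powr t)
      + (expec p (\<lambda>w. (M * L1 * L2 * marginal p ij w) powr t)
        + expec p (\<lambda>w. (L1 * marginal p Xi w) powr t)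
        + expec p (\<lambda>w. (L2 * marginal p Xj w) powr t)) / (t * ln 2)"
  shows "\<exists>f1 f2 g. (\<forall>x. f1 x < L1) \<and> (\<forall>y. f2 y < L2) \<and> (\<forall>z. g z < M) \<and>
    log 2 (M * L1 * L2) - ent (map_pmf (\<lambda>w. (g (ij w), f1 (Xi w), f2 (Xj w))) p) \<le> B \<and>
    (\<exists>J. (\<forall>w w'. Xi w = Xi w' \<and> (f1 (Xi w), f2 (Xj w)) = (f1 (Xi w'), f2 (Xj w')) \<longrightarrow> J w = J w') \<and>
       1 - B \<le> measure_pmf.prob p {w. J w = g (ij w)}) \<and>
    (\<exists>J. (\<forall>w w'. Xj w = Xj w' \<and> (f1 (Xi w), f2 (Xj w)) = (f1 (Xi w'), f2 (Xj w')) \<longrightarrow> J w = J w') \<and>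
       1 - B \<le> measure_pmf.prob p {w. J w = g (ij w)}) \<and>
    (\<exists>J. (\<forall>w w'. Xk w = Xk w' \<and> (f1 (Xi w), f2 (Xj w)) = (f1 (Xi w'), f2 (Xj w')) \<longrightarrow> J w = J w') \<and>
       1 - B \<le> measure_pmf.prob p {w. J w = g (ij w)})"
proof -
  let ?W = "set_pmf p"
  obtain S1 :: "('x \<Rightarrow> nat) pmf" where S1': "finite (set_pmf S1)" "\<forall>f\<in>set_pmf S1. \<forall>x. f x < L1"
    "\<forall>x\<in>Xi ` ?W. \<forall>y\<in>Xi ` ?W. x \<noteq> y \<longrightarrow> measure_pmf.prob S1 {f. f x = f y} \<le> 1 / L1"
    using exists_universal_hash[OF finite_imageI[OF finp] L(1), of Xi] by (elim exE conjE)
  note S1 = S1'[rule_format]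
  obtain S2 :: "('y \<Rightarrow> nat) pmf" where S2': "finite (set_pmf S2)" "\<forall>f\<in>set_pmf S2. \<forall>x. f x < L2"
    "\<forall>x\<in>Xj ` ?W. \<forall>y\<in>Xj ` ?W. x \<noteq> y \<longrightarrow> measure_pmf.prob S2 {f. f x = f y} \<le> 1 / L2"
    using exists_universal_hash[OF finite_imageI[OF finp] L(2), of Xj] by (elim exE conjE)
  note S2 = S2'[rule_format]
  obtain S3 :: "('x \<times> 'y \<Rightarrow> nat) pmf" where S3': "finite (set_pmf S3)" "\<forall>f\<in>set_pmf S3. \<forall>x. f x < M"
    "\<forall>x\<in>ij ` ?W. \<forall>y\<in>ij ` ?W. x \<noteq> y \<longrightarrow> measure_pmf.prob S3 {f. f x = f y} \<le> 1 / M"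
    using exists_universal_hash[OF finite_imageI[OF finp] L(3), of ij] by (elim exE conjE)
  note S3 = S3'[rule_format]
  define S where "S = pair_pmf S1 (pair_pmf S2 S3)"
  have finS: "finite (set_pmf S)" using S1 S2 S3 by (simp add: S_def)
  have prob_S: "measure_pmf.prob S (A \<times> A' \<times> A'') = measure_pmf.prob S1 A * (measure_pmf.prob S2 A' * measure_pmf.prob S3 A'')" for A A' A''
    unfolding S_def using S1(1) S2(1) S3(1) by (simp add: prob_pair_times)

  define F :: "('x \<Rightarrow> nat) \<times> ('y \<Rightarrow> nat) \<times> ('x \<times> 'y \<Rightarrow> nat) \<Rightarrow> 'w \<Rightarrow> nat \<times> nat" where "F = (\<lambda>s w. (fst s (Xi w), fst (snd s) (Xj w)))"
  define K :: "('x \<Rightarrow> nat) \<times> ('y \<Rightarrow> nat) \<times> ('x \<times> 'y \<Rightarrow> nat) \<Rightarrow> 'w \<Rightarrow> nat" where "K = (\<lambda>s w. snd (snd s) (ij w))"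
  define h where "h = (\<lambda>s w. (K s w, F s w))"
  have coll1: "measure_pmf.prob S {s. fst s (Xi x) = fst s (Xi w)} \<le> 1 / L1"
    if "w \<in> ?W" "x \<in> ?W" "Xi x \<noteq> Xi w" for w x
  proof -
    have *: "{s. fst s (Xi x) = fst s (Xi w)} = {f. f (Xi x) = f (Xi w)} \<times> UNIV \<times> (UNIV :: ('x \<times> 'y \<Rightarrow> nat) set)"
      by (auto simp: set_eq_iff)
    show ?thesis unfolding * prob_S using S1(3)[of "Xi x" "Xi w"] that by simp
  qed
  have coll2: "measure_pmf.prob S {s. fst (snd s) (Xj x) = fst (snd s) (Xj w)} \<le> 1 / L2"
    if "w \<in> ?W" "x \<in> ?W" "Xj x \<noteq> Xj w" for w x
  proof -
    have *: "{s. fst (snd s) (Xj x) = fst (snd s) (Xj w)} = UNIV \<times> {f. f (Xj x) = f (Xj w)} \<times> (UNIV :: ('x \<times> 'y \<Rightarrow> nat) set)"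
      by (auto simp: set_eq_iff)
    show ?thesis unfolding * prob_S using S2(3)[of "Xj x" "Xj w"] that by simp
  qed
  have coll12: "measure_pmf.prob S {s. F s x = F s w} \<le> 1 / (real L1 * real L2)"
    if "w \<in> ?W" "x \<in> ?W" "Xi x \<noteq> Xi w" "Xj x \<noteq> Xj w" for w x
  proof -
    have *: "{s. F s x = F s w} = {f. f (Xi x) = f (Xi w)} \<times> {f. f (Xj x) = f (Xj w)} \<times> (UNIV :: ('x \<times> 'y \<Rightarrow> nat) set)"
      by (auto simp: set_eq_iff F_def)
    have "measure_pmf.prob S1 {f. f (Xi x) = f (Xi w)} * measure_pmf.prob S2 {f. f (Xj x) = f (Xj w)} \<le> (1 / L1) * (1 / L2)"
      using S1(3)[of "Xi x" "Xi w"] S2(3)[of "Xj x" "Xj w"] that by (intro mult_mono) auto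
    then show ?thesis unfolding * prob_S by simp
  qed
  \<comment> \<open>For a pure hash of \<open>M * L1 * L2\<close> cells the bound would be 1. The
    extra terms account for the coordinates on which \<open>x\<close> and \<open>w\<close> agree,
    where the corresponding bin collides with certainty.\<close>
  have collh: "real (M * L1 * L2) * measure_pmf.prob S {s. h s x = h s w}
      \<le> 1 + real M * real L1 * real L2 * of_bool (ij x = ij w) + real L1 * of_bool (Xi x = Xi w) + real L2 * of_bool (Xj x = Xj w)"
    if wx: "w \<in> ?W" "x \<in> ?W" for w x
  proof (cases "ij x = ij w")
    case True
    have "real (M * L1 * L2) * measure_pmf.prob S {s. h s x = h s w} \<le> real (M * L1 * L2) * 1"
      by (intro mult_left_mono measure_pmf.prob_le_1) simp
    then show ?thesis using True by (simp add: add_nonneg_nonneg)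
  next
    case False
    let ?p1 = "measure_pmf.prob S1 {f. f (Xi x) = f (Xi w)}" and ?p2 = "measure_pmf.prob S2 {f. f (Xj x) = f (Xj w)}"
      and ?p3 = "measure_pmf.prob S3 {f. f (ij x) = f (ij w)}"
    have *: "{s. h s x = h s w} = {f. f (Xi x) = f (Xi w)} \<times> {f. f (Xj x) = f (Xj w)} \<times> {f. f (ij x) = f (ij w)}"
      by (auto simp: set_eq_iff F_def K_def h_def)
    have "real (M * L1 * L2) * measure_pmf.prob S {s. h s x = h s w} = (L1 * ?p1) * (L2 * ?p2) * (M * ?p3)"
      unfolding * prob_S by (simp add: mult_ac)
    also have "\<dots> \<le> (L1 * ?p1) * (L2 * ?p2) * 1"
      using S3(3)[of "ij x" "ij w"] False wx L by (intro mult_left_mono) (auto simp: field_simps)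
    finally have le: "real (M * L1 * L2) * measure_pmf.prob S {s. h s x = h s w} \<le> (L1 * ?p1) * (L2 * ?p2)" by simp
    have p1: "L1 * ?p1 \<le> (if Xi x = Xi w then L1 else 1)"
      using S1(3)[of "Xi x" "Xi w"] wx L measure_pmf.prob_le_1[of S1] by (auto simp: field_simps)
    have p2: "L2 * ?p2 \<le> (if Xj x = Xj w then L2 else 1)"
      using S2(3)[of "Xj x" "Xj w"] wx L measure_pmf.prob_le_1[of S2] by (auto simp: field_simps)
    have "(L1 * ?p1) * (L2 * ?p2) \<le> (if Xi x = Xi w then L1 else 1) * (if Xj x = Xj w then L2 else 1)"
      using mult_mono[OF p1 p2] by simp
    with le False show ?thesis by (auto simp: ij_def split: if_splits)
  qed

  \<comment> \<open>The three ways in which a competitor \<open>x\<close> with the same bins can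
    differ from \<open>w\<close>: only in \<open>Xi\<close>, only in \<open>Xj\<close>, or in
    both.\<close>
  define Ci where "Ci = (\<lambda>s w x. Xj x = Xj w \<and> Xi x \<noteq> Xi w \<and> F s x = F s w)"
  define Cj where "Cj = (\<lambda>s w x. Xi x = Xi w \<and> Xj x \<noteq> Xj w \<and> F s x = F s w)"
  define Cij where "Cij = (\<lambda>s w x. Xi x \<noteq> Xi w \<and> Xj x \<noteq> Xj w \<and> F s x = F s w)"
  have Ci: "measure_pmf.prob S {s. Ci s w x} \<le> 1 / L1" if "w \<in> ?W" "x \<in> ?W" for w x
  proof (cases "Xi x = Xi w")
    case False
    have "measure_pmf.prob S {s. Ci s w x} \<le> measure_pmf.prob S {s. fst s (Xi x) = fst s (Xi w)}"
      by (intro measure_pmf.finite_measure_mono) (auto simp: Ci_def F_def)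
    then show ?thesis using coll1[OF that False] by simp
  qed (simp add: Ci_def)
  have Cj: "measure_pmf.prob S {s. Cj s w x} \<le> 1 / L2" if "w \<in> ?W" "x \<in> ?W" for w x
  proof (cases "Xj x = Xj w")
    case False
    have "measure_pmf.prob S {s. Cj s w x} \<le> measure_pmf.prob S {s. fst (snd s) (Xj x) = fst (snd s) (Xj w)}"
      by (intro measure_pmf.finite_measure_mono) (auto simp: Cj_def F_def)
    then show ?thesis using coll2[OF that False] by simp
  qed (simp add: Cj_def)
  have Cij: "measure_pmf.prob S {s. Cij s w x} \<le> 1 / (real L1 * real L2)" if "w \<in> ?W" "x \<in> ?W" for w x
  proof (cases "Xi x = Xi w \<or> Xj x = Xj w")
    case False
    have "measure_pmf.prob S {s. Cij s w x} \<le> measure_pmf.prob S {s. F s x = F s w}"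
      by (intro measure_pmf.finite_measure_mono) (auto simp: Cij_def)
    then show ?thesis using coll12[OF that] False by simp
  qed (auto simp: Cij_def)
  have cong: "Ci s w x = Ci s w y" "Cj s w x = Cj s w y" "Cij s w x = Cij s w y" if "Xi x = Xi y" "Xj x = Xj y" for s w x y
    using that by (simp_all add: Ci_def Cj_def Cij_def F_def)
  have L': "0 < real L1" "0 < real L2" "0 < real L1 * real L2" using L by auto

  \<comment> \<open>\<open>E1\<close> and \<open>E2\<close> are the confusions at i and j, each of
    which knows its own coordinate; \<open>E3\<close>, \<open>E4\<close> and \<open>E5\<close> are
    those at k.\<close>
  define E1 where "E1 s = {w. \<exists>x\<in>?W. Xi x = Xi w \<and> marginal p ij w \<le> marginal p ij x \<and> Cj s w x}" for s
  define E2 where "E2 s = {w. \<exists>x\<in>?W. Xj x = Xj w \<and> marginal p ij w \<le> marginal p ij x \<and> Ci s w x}" for s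
  define E3 where "E3 s = {w. \<exists>x\<in>?W. jk x = jk w \<and> marginal p ijk w \<le> marginal p ijk x \<and> Ci s w x}" for s
  define E4 where "E4 s = {w. \<exists>x\<in>?W. ik x = ik w \<and> marginal p ijk w \<le> marginal p ijk x \<and> Cj s w x}" for s
  define E5 where "E5 s = {w. \<exists>x\<in>?W. Xk x = Xk w \<and> marginal p ijk w \<le> marginal p ijk x \<and> Cij s w x}" for s
  have E1: "expec S (\<lambda>s. measure_pmf.prob p (E1 s)) \<le> expec p (\<lambda>w. (marginal p Xi w / marginal p ij w / L2) powr t)"
    unfolding E1_def marginal_def
    by (rule expec_collision_error_le[OF finp finS L'(2) t]) (auto simp: ij_def Cj intro!: cong)
  have E2: "expec S (\<lambda>s. measure_pmf.prob p (E2 s)) \<le> expec p (\<lambda>w. (marginal p Xj w / marginal p ij w / L1) powr t)"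
    unfolding E2_def marginal_def
    by (rule expec_collision_error_le[OF finp finS L'(1) t]) (auto simp: ij_def Ci intro!: cong)
  have E3: "expec S (\<lambda>s. measure_pmf.prob p (E3 s)) \<le> expec p (\<lambda>w. (marginal p jk w / marginal p ijk w / L1) powr t)"
    unfolding E3_def marginal_def
    by (rule expec_collision_error_le[OF finp finS L'(1) t]) (auto simp: ijk_def jk_def Ci intro!: cong)
  have E4: "expec S (\<lambda>s. measure_pmf.prob p (E4 s)) \<le> expec p (\<lambda>w. (marginal p ik w / marginal p ijk w / L2) powr t)"
    unfolding E4_def marginal_def
    by (rule expec_collision_error_le[OF finp finS L'(2) t]) (auto simp: ijk_def ik_def Cj intro!: cong)
  have E5: "expec S (\<lambda>s. measure_pmf.prob p (E5 s)) \<le> expec p (\<lambda>w. (marginal p Xk w / marginal p ijk w / (L1 * L2)) powr t)"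
    unfolding E5_def marginal_def of_nat_mult
    by (rule expec_collision_error_le[OF finp finS L'(3) t]) (auto simp: ijk_def Cij intro!: cong)

  \<comment> \<open>How far key and bins together fall short of joint uniformity; this one number
    controls both the leakage and the key rate.\<close>
  define gap where "gap s = log 2 (M * L1 * L2) - ent (map_pmf (h s) p)" for s
  have gap: "expec S gap \<le> (expec p (\<lambda>w. (M * L1 * L2 * marginal p ij w) powr t)
        + expec p (\<lambda>w. (L1 * marginal p Xi w) powr t)
        + expec p (\<lambda>w. (L2 * marginal p Xj w) powr t)) / (t * ln 2)"
  proof -
    have pos: "0 < real (M * L1 * L2)" using L by simp
    have "expec S gap \<le> expec p (\<lambda>w. log 2 (real (M * L1 * L2) * expec p (\<lambda>x. measure_pmf.prob S {s. h s x = h s w})))"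
      unfolding gap_def by (rule expec_entropy_gap_le[OF finp finS pos])
    also have "\<dots> \<le> expec p (\<lambda>w. (M * L1 * L2 * marginal p ij w) powr t / (t * ln 2)
        + (L1 * marginal p Xi w) powr t / (t * ln 2) + (L2 * marginal p Xj w) powr t / (t * ln 2))"
    proof (intro expec_mono finp)
      fix w assume w: "w \<in> ?W"
      let ?a = "M * L1 * L2 * marginal p ij w" and ?b = "L1 * marginal p Xi w" and ?c = "L2 * marginal p Xj w"
      let ?e = "expec p (\<lambda>x. measure_pmf.prob S {s. h s x = h s w})"
      have nn: "0 \<le> ?a" "0 \<le> ?b" "0 \<le> ?c" by simp_all
      have e: "0 < ?e"
      proof -
        \<comment> \<open>The point \<open>x = w\<close> collides with itself for every seed, which
          keeps the argument of the logarithm positive.\<close>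
        have "0 < marginal p id w" by (rule marginal_pos[OF w])
        also have "\<dots> \<le> ?e" unfolding marginal_eq_expec
          by (intro expec_mono finp) auto
        finally show ?thesis .
      qed
      have "real (M * L1 * L2) * ?e = expec p (\<lambda>x. real (M * L1 * L2) * measure_pmf.prob S {s. h s x = h s w})"
        by simp
      also have "\<dots> \<le> expec p (\<lambda>x. 1 + real M * real L1 * real L2 * of_bool (ij x = ij w) + real L1 * of_bool (Xi x = Xi w) + real L2 * of_bool (Xj x = Xj w))"
        by (intro expec_mono finp collh w)
      also have "\<dots> = 1 + ?a + ?b + ?c"
        unfolding expec_add[OF finp] marginal_eq_expec by simp
      \<comment> \<open>The sum is enlarged to a product so that the logarithm splits into three
        terms.\<close>
      also have "\<dots> \<le> (1 + ?a) * (1 + ?b) * (1 + ?c)"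
        using nn by (simp add: algebra_simps add_nonneg_nonneg del: of_nat_mult)
      finally have "log 2 (real (M * L1 * L2) * ?e) \<le> log 2 ((1 + ?a) * (1 + ?b) * (1 + ?c))"
        using pos e by (subst log_le_cancel_iff) (auto intro!: mult_pos_pos add_pos_nonneg nn simp del: of_nat_mult)
      also have "\<dots> = log 2 (1 + ?a) + log 2 (1 + ?b) + log 2 (1 + ?c)"
      proof -
        have "0 < 1 + ?a" "0 < 1 + ?b" "0 < 1 + ?c" using nn by linarith+
        then show ?thesis by (simp add: log_mult less_imp_neq[symmetric] del: of_nat_mult)
      qed
      also have "\<dots> \<le> ?a powr t / (t * ln 2) + ?b powr t / (t * ln 2) + ?c powr t / (t * ln 2)"
        by (intro add_mono log2_one_plus_le nn t)
      finally show "log 2 (real (M * L1 * L2) * ?e) \<le> \<dots>" .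
    qed
    finally show ?thesis by (simp add: expec_add[OF finp] add_divide_distrib)
  qed

  \<comment> \<open>All summands are nonnegative, so a seed with \<open>T s \<le> B\<close> bounds
    each of them by \<open>B\<close>.\<close>
  define T where "T s = measure_pmf.prob p (E1 s) + measure_pmf.prob p (E2 s) + measure_pmf.prob p (E3 s)
    + measure_pmf.prob p (E4 s) + measure_pmf.prob p (E5 s) + gap s" for s
  have "expec S T \<le> B"
    unfolding T_def expec_add[OF finS] B_def by (intro add_mono E1 E2 E3 E4 E5 gap)
  then obtain s where s: "s \<in> set_pmf S" "T s \<le> B"
    using exists_le_expec[OF finS, of T] by force
  obtain f1 f2 g where sfg: "s = (f1, f2, g)" by (cases s) auto
  have bnd: "\<And>x. f1 x < L1" "\<And>x. f2 x < L2" "\<And>x. g x < M"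
    using s(1) S1(2) S2(2) S3(2) by (auto simp: S_def sfg)
  have "ent (map_pmf (h s) p) \<le> log 2 (card ({..<M} \<times> {..<L1} \<times> {..<L2}))"
    by (rule ent_le_log_card) (use bnd(1,2) bnd(3)[of "ij w" for w] in \<open>auto simp: h_def K_def F_def sfg\<close>)
  then have gap0: "0 \<le> gap s" by (simp add: gap_def mult_ac)
  have nn: "0 \<le> measure_pmf.prob p (E1 s)" "0 \<le> measure_pmf.prob p (E2 s)" "0 \<le> measure_pmf.prob p (E3 s)"
    "0 \<le> measure_pmf.prob p (E4 s)" "0 \<le> measure_pmf.prob p (E5 s)"
    by simp_all
  have T: "measure_pmf.prob p (E1 s) \<le> B" "measure_pmf.prob p (E2 s) \<le> B" "gap s \<le> B"
    "measure_pmf.prob p (E3 s) + measure_pmf.prob p (E4 s) + measure_pmf.prob p (E5 s) \<le> B"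
    using s(2) gap0 nn unfolding T_def by linarith+
  have prob3: "measure_pmf.prob p (E3 s \<union> E4 s \<union> E5 s) \<le> B"
  proof -
    have "measure_pmf.prob p (E3 s \<union> E4 s \<union> E5 s) \<le> measure_pmf.prob p (E3 s \<union> E4 s) + measure_pmf.prob p (E5 s)"
      by (intro measure_Un_le) auto
    also have "measure_pmf.prob p (E3 s \<union> E4 s) \<le> measure_pmf.prob p (E3 s) + measure_pmf.prob p (E4 s)"
      by (intro measure_Un_le) auto
    finally show ?thesis using T(4) by simp
  qed
  have d1: "\<exists>J. (\<forall>w w'. Xi w = Xi w' \<and> F s w = F s w' \<longrightarrow> J w = J w') \<and> 1 - B \<le> measure_pmf.prob p {w. J w = K s w}"
    by (rule exists_reliable_decoder[OF finp _ T(1), where q = "marginal p ij"]) (auto simp: E1_def Cj_def ij_def K_def)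
  have d2: "\<exists>J. (\<forall>w w'. Xj w = Xj w' \<and> F s w = F s w' \<longrightarrow> J w = J w') \<and> 1 - B \<le> measure_pmf.prob p {w. J w = K s w}"
    by (rule exists_reliable_decoder[OF finp _ T(2), where q = "marginal p ij"]) (auto simp: E2_def Ci_def ij_def K_def)
  have d3: "\<exists>J. (\<forall>w w'. Xk w = Xk w' \<and> F s w = F s w' \<longrightarrow> J w = J w') \<and> 1 - B \<le> measure_pmf.prob p {w. J w = K s w}"
  proof (rule exists_reliable_decoder[OF finp _ prob3, where q = "marginal p ijk"])
    fix w x assume *: "x \<in> ?W" "Xk x = Xk w" "F s x = F s w" "marginal p ijk w \<le> marginal p ijk x" "K s x \<noteq> K s w"
    \<comment> \<open>Different keys force different pairs \<open>ij\<close>, so at least one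
      coordinate is wrong.\<close>
    consider "Xi x = Xi w" "Xj x \<noteq> Xj w" | "Xi x \<noteq> Xi w" "Xj x = Xj w" | "Xi x \<noteq> Xi w" "Xj x \<noteq> Xj w"
      using *(5) by (cases "Xi x = Xi w"; cases "Xj x = Xj w") (auto simp: ij_def K_def)
    then show "w \<in> E3 s \<union> E4 s \<union> E5 s"
    proof cases
      case 1
      with * have "w \<in> E4 s" by (auto simp: E4_def Cj_def ik_def)
      then show ?thesis by simp
    next
      case 2
      with * have "w \<in> E3 s" by (auto simp: E3_def Ci_def jk_def)
      then show ?thesis by simp
    next
      case 3
      with * have "w \<in> E5 s" by (auto simp: E5_def Cij_def)
      then show ?thesis by simp
    qed
  qed
  show ?thesis
    using bnd T(3) d1 d2 d3
    by (intro exI[of _ f1] exI[of _ f2] exI[of _ g]) (simp add: gap_def h_def F_def K_def sfg)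
qed

section \<open>Error exponents\<close>

lemma marginal_cong:
  assumes "\<And>x y. f x = f y \<longleftrightarrow> g x = g y"
  shows "marginal p f w = marginal p g w"
  unfolding marginal_eq_expec by (simp add: assms)

lemma marginal_map_iid:
  assumes "length w = n"
  shows "marginal (iid P n) (map f) w = prod_list (map (marginal P f) w)"
  using assms unfolding marginal_def map_iid by (simp add: pmf_iid o_def)

lemma HA_eq_expec:
  fixes P :: "('a::finite \<times> 'b::finite \<times> 'c::finite) pmf"
  shows "HA P A = expec P (\<lambda>x. - log 2 (marginal P (proj A) x))"
  unfolding HA_def marginal_def by (rule ent_map_eq_expec) simp

lemma prod_list_map_divide:
  fixes f g :: "'x \<Rightarrow> real"
  shows "prod_list (map (\<lambda>x. f x / g x) w) = prod_list (map f w) / prod_list (map g w)"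
  by (induction w) simp_all

lemma HA_mono:
  fixes P :: "('a::finite \<times> 'b::finite \<times> 'c::finite) pmf"
  assumes "A \<subseteq> B"
  shows "HA P A \<le> HA P B"
  unfolding HA_def
proof (rule ent_map_mono)
  show "proj A x = proj A y" if "proj B x = proj B y" for x y :: "'a \<times> 'b \<times> 'c"
    using proj_Un_eq_iff[of A B x y] that assms by (simp add: Un_absorb1)
qed simp

lemma HA_submodular:
  fixes P :: "('a::finite \<times> 'b::finite \<times> 'c::finite) pmf"
  shows "HA P (A \<union> B \<union> C) + HA P C \<le> HA P (A \<union> C) + HA P (B \<union> C)"
proof -
  have fin: "finite (set_pmf P)" by simp
  have "HA P (A \<union> B \<union> C) = ent (map_pmf (\<lambda>x. (proj A x, proj B x, proj C x)) P)"
    "HA P (A \<union> C) = ent (map_pmf (\<lambda>x. (proj A x, proj C x)) P)"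
    "HA P (B \<union> C) = ent (map_pmf (\<lambda>x. (proj B x, proj C x)) P)"
    unfolding HA_def by (rule ent_map_cong[OF fin]; simp add: proj_Un_eq_iff)+
  then show ?thesis using ent_submodular[OF fin, of "proj A" "proj B" "proj C"] by (simp add: HA_def)
qed

text \<open>The mean log-likelihood ratio is \<open>HA P B - HA P A\<close>. For
  \<open>A \<subseteq> B\<close> this is a conditional entropy, and the condition on
  \<open>r\<close> is of Slepian-Wolf type.\<close>

lemma eventually_decoding_exponent:
  fixes P :: "('a::finite \<times> 'b::finite \<times> 'c::finite) pmf"
  assumes "HA P B - HA P A < r"
  shows "\<forall>\<^sub>F t in at_right 0. expec P (\<lambda>x. (marginal P (proj A) x / marginal P (proj B) x) powr t) < 2 powr (r * t)"
proof (rule eventually_expec_powr_less)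
  have fin: "finite (set_pmf P)" by simp
  have "expec P (\<lambda>x. log 2 (marginal P (proj A) x / marginal P (proj B) x))
      = expec P (\<lambda>x. - log 2 (marginal P (proj B) x) - - log 2 (marginal P (proj A) x))"
    by (intro expec_cong fin) (simp add: log_divide marginal_pos less_imp_neq[symmetric])
  also have "\<dots> = HA P B - HA P A" unfolding expec_diff[OF fin] HA_eq_expec ..
  finally show "expec P (\<lambda>x. log 2 (marginal P (proj A) x / marginal P (proj B) x)) < r" using assms by simp
qed (simp_all add: marginal_pos)

text \<open>The mean log-likelihood is \<open>- HA P A\<close>, so hashing at a rate
  \<open>r\<close> below this entropy is nearly uniform.\<close>

lemma eventually_secrecy_exponent:
  fixes P :: "('a::finite \<times> 'b::finite \<times> 'c::finite) pmf"
  assumes "r < HA P A"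
  shows "\<forall>\<^sub>F t in at_right 0. expec P (\<lambda>x. marginal P (proj A) x powr t) < 2 powr (- r * t)"
proof (rule eventually_expec_powr_less)
  have fin: "finite (set_pmf P)" by simp
  have "HA P A = expec P (\<lambda>x. 0 - log 2 (marginal P (proj A) x))" by (simp add: HA_eq_expec)
  then show "expec P (\<lambda>x. log 2 (marginal P (proj A) x)) < - r" using assms
    by (simp only: expec_diff[OF fin]) simp
qed (simp_all add: marginal_pos)

text \<open>\<open>f\<close> and \<open>g\<close> are fixed only up to the partitions they induce,
  so tuples of single observations may replace joint projections. Rounding \<open>L n\<close>
  upwards only decreases the error.\<close>

lemma decoding_error_tendsto_0:
  fixes P :: "('a::finite \<times> 'b::finite \<times> 'c::finite) pmf" and L :: "nat \<Rightarrow> real"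
    and f :: "('a \<times> 'b \<times> 'c) list \<Rightarrow> 'u" and g :: "('a \<times> 'b \<times> 'c) list \<Rightarrow> 'v"
  assumes t: "0 < t" and less: "expec P (\<lambda>x. (marginal P (proj A) x / marginal P (proj B) x) powr t) < 2 powr (r * t)"
    and L: "\<And>n. 2 powr (n * r) \<le> L n"
    and f: "\<And>x y. f x = f y \<longleftrightarrow> map (proj A) x = map (proj A) y"
    and g: "\<And>x y. g x = g y \<longleftrightarrow> map (proj B) x = map (proj B) y"
  shows "(\<lambda>n. expec (iid P n) (\<lambda>w. (marginal (iid P n) f w / marginal (iid P n) g w / L n) powr t)) \<longlonglongrightarrow> 0"
proof (rule tendsto_sandwich[OF always_eventually always_eventually tendsto_const])
  let ?\<phi> = "\<lambda>x. marginal P (proj A) x / marginal P (proj B) x"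
  let ?u = "\<lambda>n. expec (iid P n) (\<lambda>w. (prod_list (map ?\<phi> w) / 2 powr (n * r)) powr t)"
  show "?u \<longlonglongrightarrow> 0"
    by (rule expec_iid_powr_tendsto_0[OF _ _ less]) (simp_all add: marginal_pos)
  show "\<forall>n. expec (iid P n) (\<lambda>w. (marginal (iid P n) f w / marginal (iid P n) g w / L n) powr t) \<le> ?u n"
  proof (intro allI expec_mono finite_set_iid)
    fix n w assume "w \<in> set_pmf (iid P n)"
    then have w: "length w = n" by (simp add: set_iid)
    have "marginal (iid P n) f w = prod_list (map (marginal P (proj A)) w)"
      "marginal (iid P n) g w = prod_list (map (marginal P (proj B)) w)"
      using marginal_cong[of f "map (proj A)", OF f] marginal_cong[of g "map (proj B)", OF g]
      by (simp_all add: marginal_map_iid[OF w])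
    then have eq: "prod_list (map ?\<phi> w) = marginal (iid P n) f w / marginal (iid P n) g w"
      by (simp add: prod_list_map_divide)
    show "(marginal (iid P n) f w / marginal (iid P n) g w / L n) powr t \<le> (prod_list (map ?\<phi> w) / 2 powr (n * r)) powr t"
      unfolding eq using t L[of n] less_le_trans[OF _ L[of n], of 0]
      by (intro powr_mono2 divide_left_mono mult_pos_pos) auto
  qed simp
  show "\<forall>n. 0 \<le> expec (iid P n) (\<lambda>w. (marginal (iid P n) f w / marginal (iid P n) g w / L n) powr t)"
    by (intro allI Bochner_Integration.integral_nonneg) simp
qed

text \<open>Here rounding upwards hurts, so a constant factor \<open>c\<close> is allowed; it
  contributes only the fixed factor \<open>c powr t\<close>.\<close>

lemma secrecy_error_tendsto_0:
  fixes P :: "('a::finite \<times> 'b::finite \<times> 'c::finite) pmf" and L :: "nat \<Rightarrow> real"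
    and f :: "('a \<times> 'b \<times> 'c) list \<Rightarrow> 'u"
  assumes t: "0 < t" and less: "expec P (\<lambda>x. marginal P (proj A) x powr t) < 2 powr (- r * t)"
    and L: "\<And>n. 0 \<le> L n" "\<And>n. L n \<le> c * 2 powr (n * r)"
    and f: "\<And>x y. f x = f y \<longleftrightarrow> map (proj A) x = map (proj A) y"
  shows "(\<lambda>n. expec (iid P n) (\<lambda>w. (L n * marginal (iid P n) f w) powr t)) \<longlonglongrightarrow> 0"
proof (rule tendsto_sandwich[OF always_eventually always_eventually tendsto_const])
  let ?\<phi> = "marginal P (proj A)"
  let ?u = "\<lambda>n. c powr t * expec (iid P n) (\<lambda>w. (prod_list (map ?\<phi> w) / 2 powr (n * - r)) powr t)"
  have "(\<lambda>n. expec (iid P n) (\<lambda>w. (prod_list (map ?\<phi> w) / 2 powr (n * - r)) powr t)) \<longlonglongrightarrow> 0"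
    by (rule expec_iid_powr_tendsto_0[OF _ _ less]) (simp_all add: marginal_pos)
  then show "?u \<longlonglongrightarrow> 0" by (rule tendsto_mult_right_zero)
  have c: "0 \<le> c" using L(1)[of 0] L(2)[of 0] by simp
  show "\<forall>n. expec (iid P n) (\<lambda>w. (L n * marginal (iid P n) f w) powr t) \<le> ?u n"
  proof
    fix n
    have "expec (iid P n) (\<lambda>w. (L n * marginal (iid P n) f w) powr t)
      \<le> expec (iid P n) (\<lambda>w. c powr t * (prod_list (map ?\<phi> w) / 2 powr (n * - r)) powr t)"
    proof (intro expec_mono finite_set_iid)
      fix w assume "w \<in> set_pmf (iid P n)"
      then have w: "length w = n" by (simp add: set_iid)
      have eq: "prod_list (map ?\<phi> w) = marginal (iid P n) f w"
        using marginal_cong[of f "map (proj A)", OF f] by (simp add: marginal_map_iid[OF w])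
      have "(L n * marginal (iid P n) f w) powr t \<le> (c * 2 powr (n * r) * marginal (iid P n) f w) powr t"
        using t L by (intro powr_mono2 mult_right_mono) auto
      also have "\<dots> = c powr t * (marginal (iid P n) f w / 2 powr (n * - r)) powr t"
        using c by (simp add: powr_mult[symmetric] powr_minus field_simps)
      finally show "(L n * marginal (iid P n) f w) powr t \<le> c powr t * (prod_list (map ?\<phi> w) / 2 powr (n * - r)) powr t"
        unfolding eq .
    qed simp
    then show "expec (iid P n) (\<lambda>w. (L n * marginal (iid P n) f w) powr t) \<le> ?u n" by simp
  qed
  show "\<forall>n. 0 \<le> expec (iid P n) (\<lambda>w. (L n * marginal (iid P n) f w) powr t)"
    by (intro allI Bochner_Integration.integral_nonneg) simp
qed

text \<open>Nonnegative rates make the power at least 1, so rounding up at most doubles it.\<close>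

lemma nat_ceiling_powr_bounds:
  assumes "0 \<le> r"
  shows "2 powr (real n * r) \<le> real (nat \<lceil>2 powr (real n * r)\<rceil>)"
    and "real (nat \<lceil>2 powr (real n * r)\<rceil>) \<le> 2 * 2 powr (real n * r)"
    and "0 < nat \<lceil>2 powr (real n * r)\<rceil>"
proof -
  have "1 \<le> 2 powr (real n * r)" using assms by (intro ge_one_powr_ge_zero) auto
  moreover have "real_of_int \<lceil>2 powr (real n * r)\<rceil> \<le> 2 powr (real n * r) + 1" "2 powr (real n * r) \<le> real_of_int \<lceil>2 powr (real n * r)\<rceil>" by linarith+
  ultimately show "2 powr (real n * r) \<le> real (nat \<lceil>2 powr (real n * r)\<rceil>)"
    "real (nat \<lceil>2 powr (real n * r)\<rceil>) \<le> 2 * 2 powr (real n * r)"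
    "0 < nat \<lceil>2 powr (real n * r)\<rceil>" by linarith+
qed

section \<open>Two transmitting terminals\<close>

lemma prob_all3_ge:
  assumes "1 - \<delta> \<le> measure_pmf.prob p {w. R1 w}" "1 - \<delta> \<le> measure_pmf.prob p {w. R2 w}" "1 - \<delta> \<le> measure_pmf.prob p {w. R3 w}"
  shows "1 - 3 * \<delta> \<le> measure_pmf.prob p {w. R1 w \<and> R2 w \<and> R3 w}"
proof -
  have compl: "measure_pmf.prob p {w. \<not> R w} = 1 - measure_pmf.prob p {w. R w}" for R
    using measure_pmf.prob_compl[of "{w. R w}" p] by (simp add: set_diff_eq)
  have "measure_pmf.prob p {w. \<not> (R1 w \<and> R2 w \<and> R3 w)} \<le> measure_pmf.prob p ({w. \<not> R1 w} \<union> ({w. \<not> R2 w} \<union> {w. \<not> R3 w}))"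
    by (intro measure_pmf.finite_measure_mono) auto
  moreover have "\<dots> \<le> measure_pmf.prob p {w. \<not> R1 w} + measure_pmf.prob p ({w. \<not> R2 w} \<union> {w. \<not> R3 w})"
    by (rule measure_Un_le) auto
  moreover have "measure_pmf.prob p ({w. \<not> R2 w} \<union> {w. \<not> R3 w}) \<le> measure_pmf.prob p {w. \<not> R2 w} + measure_pmf.prob p {w. \<not> R3 w}"
    by (rule measure_Un_le) auto
  ultimately show ?thesis using assms unfolding compl by linarith
qed

text \<open>The entropies of key and transcript are at most the logarithms of their ranges. A nearly
  maximal joint entropy therefore forces them to be nearly independent and the key to be nearly
  uniform.\<close>

lemma mutinf_le_entropy_gap:
  fixes f1 f2 g :: "'w \<Rightarrow> nat" and L1 L2 M :: nat
  assumes fin: "finite (set_pmf p)" and bnd: "\<And>w. f1 w < L1" "\<And>w. f2 w < L2" "\<And>w. g w < M"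
    and F: "\<And>w. F w = [f1 w, f2 w]"
    and gap: "log 2 (M * L1 * L2) - ent (map_pmf (\<lambda>w. (g w, f1 w, f2 w)) p) \<le> B"
  shows "mutinf p g F \<le> B \<and> log 2 M - B \<le> ent (map_pmf g p)"
proof -
  \<comment> \<open>A strict upper bound on a natural number at any one point already makes the
    bound positive.\<close>
  have pos: "0 < L1" "0 < L2" "0 < M"
    using bnd(1)[of undefined] bnd(2)[of undefined] bnd(3)[of undefined] by simp_all
  have F_eq: "ent (map_pmf F p) = ent (map_pmf (\<lambda>w. (f1 w, f2 w)) p)"
    "ent (map_pmf (\<lambda>w. (g w, F w)) p) = ent (map_pmf (\<lambda>w. (g w, f1 w, f2 w)) p)"
    by (rule ent_map_cong[OF fin]; simp add: F)+
  have "ent (map_pmf (\<lambda>w. (f1 w, f2 w)) p) \<le> log 2 (card ({..<L1} \<times> {..<L2}))"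
    by (rule ent_le_log_card) (use bnd in auto)
  moreover have "ent (map_pmf g p) \<le> log 2 (card {..<M})"
    by (rule ent_le_log_card) (use bnd in auto)
  moreover have "ent (map_pmf (\<lambda>w. (g w, F w)) p) \<le> ent (map_pmf g p) + ent (map_pmf F p)"
    by (rule ent_subadditive[OF fin])
  moreover have "log 2 (M * L1 * L2) = log 2 M + log 2 (L1 * L2)"
    using pos by (simp add: log_mult)
  ultimately show ?thesis using gap unfolding mutinf_def F_eq by simp
qed

text \<open>The binning rates \<open>H(i|j) + \<tau>\<close> and \<open>H(j|i) + \<tau>\<close> let
  i and j learn each other's observation. They sum to slightly more than \<open>H(ij|k)\<close>,
  which k needs, and adding the key rate stays below \<open>H(ij)\<close>, which secrecy
  needs.\<close>

lemma sk_achievable_two_transmitters: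
  fixes P :: "('a::finite \<times> 'b::finite \<times> 'c::finite) pmf"
  assumes ijk: "terms = {i, j, k}"
    and \<delta>: "0 < \<delta>" "2 * \<delta> \<le> HA P {i, j} + HA P {k} - HA P terms"
    and le: "HA P {i, j} + HA P {k} - HA P terms \<le> HA P {i} + HA P {j} - HA P {i, j}"
  shows "sk_achievable P {i, j} (HA P {i, j} + HA P {k} - HA P terms - 2 * \<delta>)"
proof -
  define Iij where "Iij = HA P {i} + HA P {j} - HA P {i, j}"
  define Ik where "Ik = HA P {i, j} + HA P {k} - HA P terms"
  \<comment> \<open>Chosen so that \<open>R1 + R2 = H(ij|k) + \<delta>\<close>; with
    \<open>RK\<close> the total becomes \<open>H(ij) - \<delta>\<close>.\<close>
  define \<tau> where "\<tau> = (Iij - Ik + \<delta>) / 2"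
  define R1 where "R1 = HA P {i, j} - HA P {j} + \<tau>"
  define R2 where "R2 = HA P {i, j} - HA P {i} + \<tau>"
  define RK where "RK = Ik - 2 * \<delta>"
  \<comment> \<open>Positivity is where \<open>le\<close> is needed; \<open>\<tau> < Iij\<close>
    says \<open>R1 < H(i)\<close> and \<open>R2 < H(j)\<close>, so the bins themselves are nearly
    uniform.\<close>
  have \<tau>: "0 < \<tau>" "\<tau> < Iij" using \<delta> le by (auto simp: \<tau>_def Iij_def Ik_def)
  have R: "0 \<le> R1" "0 \<le> R2" "0 \<le> RK"
    using HA_mono[of "{i}" "{i, j}" P] HA_mono[of "{j}" "{i, j}" P] \<tau> \<delta> by (auto simp: R1_def R2_def RK_def Ik_def)
  \<comment> \<open>Extra conditioning on k reduces entropy, so the individual rates that suffice at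
    i and j also suffice at k.\<close>
  have sub: "HA P {i, j, k} - HA P {j, k} \<le> HA P {i, j} - HA P {j}" "HA P {i, j, k} - HA P {i, k} \<le> HA P {i, j} - HA P {i}"
    using HA_submodular[of P "{i}" "{k}" "{j}"] HA_submodular[of P "{j}" "{k}" "{i}"] by (simp_all add: insert_commute)
  define L1 where "L1 n = nat \<lceil>2 powr (real n * R1)\<rceil>" for n
  define L2 where "L2 n = nat \<lceil>2 powr (real n * R2)\<rceil>" for n
  define M where "M n = nat \<lceil>2 powr (real n * RK)\<rceil>" for n
  note L1 = nat_ceiling_powr_bounds[OF R(1), folded L1_def]
  note L2 = nat_ceiling_powr_bounds[OF R(2), folded L2_def]
  note M = nat_ceiling_powr_bounds[OF R(3), folded M_def]
  have L12: "2 powr (n * (R1 + R2)) \<le> real (L1 n * L2 n)" for n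
    using mult_mono[OF L1(1) L2(1), of n n] by (simp add: ring_distribs powr_add)
  have prod_le: "real (M n * L1 n * L2 n) \<le> 8 * 2 powr (n * (RK + R1 + R2))" for n
  proof -
    have "real (M n) * real (L1 n) * real (L2 n) \<le> (2 * 2 powr (n * RK)) * (2 * 2 powr (n * R1)) * (2 * 2 powr (n * R2))"
      by (intro mult_mono M L1 L2) auto
    then show ?thesis by (simp add: ring_distribs powr_add mult_ac)
  qed

  \<comment> \<open>Each exponent condition holds for all small positive \<open>t\<close>, so one
    \<open>t\<close> serves the five decoding errors and the three secrecy terms.\<close>
  have "\<forall>\<^sub>F t in at_right 0. (0 < t \<and> t < 1) \<and>
      expec P (\<lambda>x. (marginal P (proj {i}) x / marginal P (proj {i, j}) x) powr t) < 2 powr (R2 * t) \<and>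
      expec P (\<lambda>x. (marginal P (proj {j}) x / marginal P (proj {i, j}) x) powr t) < 2 powr (R1 * t) \<and>
      expec P (\<lambda>x. (marginal P (proj {j, k}) x / marginal P (proj {i, j, k}) x) powr t) < 2 powr (R1 * t) \<and>
      expec P (\<lambda>x. (marginal P (proj {i, k}) x / marginal P (proj {i, j, k}) x) powr t) < 2 powr (R2 * t) \<and>
      expec P (\<lambda>x. (marginal P (proj {k}) x / marginal P (proj {i, j, k}) x) powr t) < 2 powr ((R1 + R2) * t) \<and>
      expec P (\<lambda>x. marginal P (proj {i, j}) x powr t) < 2 powr (- (RK + R1 + R2) * t) \<and>
      expec P (\<lambda>x. marginal P (proj {i}) x powr t) < 2 powr (- R1 * t) \<and>
      expec P (\<lambda>x. marginal P (proj {j}) x powr t) < 2 powr (- R2 * t)"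
  proof (intro eventually_conj eventually_decoding_exponent eventually_secrecy_exponent)
    show "\<forall>\<^sub>F t in at_right (0::real). 0 < t" by (rule eventually_at_right_less)
    show "\<forall>\<^sub>F t in at_right (0::real). t < 1"
      using eventually_at_right_real[of 0 "1::real"] by (auto elim: eventually_mono)
  qed (use \<tau> \<delta> sub ijk in \<open>auto simp: R1_def R2_def RK_def \<tau>_def Iij_def Ik_def field_simps\<close>)
  from eventually_happens'[OF _ this] obtain t where t: "0 < t" "t < 1"
    and t1: "expec P (\<lambda>x. (marginal P (proj {i}) x / marginal P (proj {i, j}) x) powr t) < 2 powr (R2 * t)"
    and t2: "expec P (\<lambda>x. (marginal P (proj {j}) x / marginal P (proj {i, j}) x) powr t) < 2 powr (R1 * t)"
    and t3: "expec P (\<lambda>x. (marginal P (proj {j, k}) x / marginal P (proj {i, j, k}) x) powr t) < 2 powr (R1 * t)"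
    and t4: "expec P (\<lambda>x. (marginal P (proj {i, k}) x / marginal P (proj {i, j, k}) x) powr t) < 2 powr (R2 * t)"
    and t5: "expec P (\<lambda>x. (marginal P (proj {k}) x / marginal P (proj {i, j, k}) x) powr t) < 2 powr ((R1 + R2) * t)"
    and t6: "expec P (\<lambda>x. marginal P (proj {i, j}) x powr t) < 2 powr (- (RK + R1 + R2) * t)"
    and t7: "expec P (\<lambda>x. marginal P (proj {i}) x powr t) < 2 powr (- R1 * t)"
    and t8: "expec P (\<lambda>x. marginal P (proj {j}) x powr t) < 2 powr (- R2 * t)"
    by auto

  define X where "X l = (map (proj {l}) :: ('a \<times> 'b \<times> 'c) list \<Rightarrow> _)" for l
  let ?ij = "\<lambda>w. (X i w, X j w)" and ?ik = "\<lambda>w. (X i w, X k w)" and ?jk = "\<lambda>w. (X j w, X k w)"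
    and ?ijk = "\<lambda>w. (X i w, X j w, X k w)"
  have X1: "X l x = X l y \<longleftrightarrow> map (proj {l}) x = map (proj {l}) y" for l x y
    by (simp add: X_def)
  have X2: "(X l x, X l' x) = (X l y, X l' y) \<longleftrightarrow> map (proj {l, l'}) x = map (proj {l, l'}) y" for l l' x y
    unfolding X_def insert_is_Un[of l "{l'}"] map_proj_Un_eq_iff by simp
  have X3: "?ijk x = ?ijk y \<longleftrightarrow> map (proj {i, j, k}) x = map (proj {i, j, k}) y" for x y
    using map_proj_Un_eq_iff[of "{i}" "{j, k}" x y, folded insert_is_Un[of i "{j, k}"]]
      map_proj_Un_eq_iff[of "{j}" "{k}" x y, folded insert_is_Un[of j "{k}"]] by (simp add: X_def)
  \<comment> \<open>The one-shot bound at blocklength \<open>n\<close>; its eight moments vanish by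
    \<open>t1\<close> to \<open>t8\<close>.\<close>
  define B where "B n = (let p = iid P n in
        expec p (\<lambda>w. (marginal p (X i) w / marginal p ?ij w / L2 n) powr t)
      + expec p (\<lambda>w. (marginal p (X j) w / marginal p ?ij w / L1 n) powr t)
      + expec p (\<lambda>w. (marginal p ?jk w / marginal p ?ijk w / L1 n) powr t)
      + expec p (\<lambda>w. (marginal p ?ik w / marginal p ?ijk w / L2 n) powr t)
      + expec p (\<lambda>w. (marginal p (X k) w / marginal p ?ijk w / (L1 n * L2 n)) powr t)
      + (expec p (\<lambda>w. (M n * L1 n * L2 n * marginal p ?ij w) powr t)
        + expec p (\<lambda>w. (L1 n * marginal p (X i) w) powr t)
        + expec p (\<lambda>w. (L2 n * marginal p (X j) w) powr t)) / (t * ln 2))" for n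
  have "B \<longlonglongrightarrow> 0 + 0 + 0 + 0 + 0 + (0 + 0 + 0) / (t * ln 2)"
    unfolding B_def Let_def
  proof (intro tendsto_add tendsto_divide tendsto_const)
    show "(\<lambda>n. expec (iid P n) (\<lambda>w. (M n * L1 n * L2 n * marginal (iid P n) ?ij w) powr t)) \<longlonglongrightarrow> 0"
      by (rule secrecy_error_tendsto_0[OF t(1) t6 _ prod_le X2]) simp
    show "(\<lambda>n. expec (iid P n) (\<lambda>w. (L1 n * marginal (iid P n) (X i) w) powr t)) \<longlonglongrightarrow> 0"
      by (rule secrecy_error_tendsto_0[OF t(1) t7 _ L1(2) X1]) simp
    show "(\<lambda>n. expec (iid P n) (\<lambda>w. (L2 n * marginal (iid P n) (X j) w) powr t)) \<longlonglongrightarrow> 0"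
      by (rule secrecy_error_tendsto_0[OF t(1) t8 _ L2(2) X1]) simp
  qed (rule decoding_error_tendsto_0[OF t(1) t1 L2(1) X1 X2] decoding_error_tendsto_0[OF t(1) t2 L1(1) X1 X2]
      decoding_error_tendsto_0[OF t(1) t3 L1(1) X2 X3] decoding_error_tendsto_0[OF t(1) t4 L2(1) X2 X3]
      decoding_error_tendsto_0[OF t(1) t5 L12 X1 X3] | use t in simp)+
  then have B0: "B \<longlonglongrightarrow> 0" by simp

  \<comment> \<open>Bundling the code into a triple allows one choice of codes for all
    \<open>n\<close>.\<close>
  define good where "good n c \<longleftrightarrow> (case c of (f1, f2, g) \<Rightarrow>
    (\<forall>x. f1 x < L1 n) \<and> (\<forall>x. f2 x < L2 n) \<and> (\<forall>x. g x < M n) \<and>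
    log 2 (M n * L1 n * L2 n) - ent (map_pmf (\<lambda>w. (g (?ij w), f1 (X i w), f2 (X j w))) (iid P n)) \<le> B n \<and>
    (\<forall>l\<in>{i, j, k}. \<exists>J. (\<forall>w w'. X l w = X l w' \<and> (f1 (X i w), f2 (X j w)) = (f1 (X i w'), f2 (X j w')) \<longrightarrow> J w = J w') \<and>
       1 - B n \<le> measure_pmf.prob (iid P n) {w. J w = g (?ij w)}))" for n c
  have "\<exists>c. good n c" for n
  proof -
    have fin: "finite (set_pmf (iid P n))" by (simp add: finite_set_iid)
    from exists_random_binning_code[OF fin L1(3) L2(3) M(3) t(1) less_imp_le[OF t(2)], of n n n "X i" "X j" "X k"]
    show ?thesis unfolding good_def B_def Let_def by (simp del: prod.inject)
  qed
  then obtain c where "\<And>n. good n (c n)" by metis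
  then have good: "good n (fst (c n), fst (snd (c n)), snd (snd (c n)))" for n by simp
  define f1 where "f1 n = fst (c n)" for n
  define f2 where "f2 n = fst (snd (c n))" for n
  define g where "g n = snd (snd (c n))" for n
  note good = good[folded f1_def f2_def g_def, unfolded good_def prod.case]
  note good_bnd = good[THEN conjunct1, rule_format] good[THEN conjunct2, THEN conjunct1, rule_format]
    good[THEN conjunct2, THEN conjunct2, THEN conjunct1, rule_format]
  note good_gap = good[THEN conjunct2, THEN conjunct2, THEN conjunct2, THEN conjunct1]
  note good_dec = good[THEN conjunct2, THEN conjunct2, THEN conjunct2, THEN conjunct2]
  \<comment> \<open>Each rule ignores the earlier messages: the scheme needs one transmission from
    each of i and j and no interaction.\<close>
  define ps where "ps n = [(i, \<lambda>w ms :: nat list. f1 n (X i w)), (j, \<lambda>w ms. f2 n (X j w))]" for n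
  define K where "K n w = g n (?ij w)" for n w
  have run: "run (ps n) w = [f1 n (X i w), f2 n (X j w)]" for n w
    by (simp add: run_def ps_def)
  have mem: "i \<in> terms" "j \<in> terms" "k \<in> terms" using ijk by auto
  have valid: "valid_protocol {i, j} (ps n)" for n
    using mem by (simp add: valid_protocol_def ps_def local_eq_iff X_def)
  have B_small: "\<forall>\<^sub>F n in sequentially. B n \<le> \<epsilon>" if "0 < \<epsilon>" for \<epsilon>
    using order_tendstoD(2)[OF B0 that] by (auto elim: eventually_mono)
  have cr: "is_CR P ps K"
    unfolding is_CR_def
  proof (intro allI impI)
    fix \<epsilon> :: real assume \<epsilon>: "0 < \<epsilon> \<and> \<epsilon> < 1"
    show "\<forall>\<^sub>F n in sequentially. \<exists>Jl :: nat \<Rightarrow> ('a \<times> 'b \<times> 'c) list \<Rightarrow> nat.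
        (\<forall>i\<in>terms. \<forall>w w'. local_eq i w w' \<and> run (ps n) w = run (ps n) w' \<longrightarrow> Jl i w = Jl i w') \<and>
        1 - \<epsilon> \<le> measure_pmf.prob (iid P n) {w. \<forall>i\<in>terms. Jl i w = K n w}"
      \<comment> \<open>A third of the error for each of the three decoders.\<close>
      using B_small[of "\<epsilon> / 3"]
    proof (rule eventually_mono)
      fix n assume Bn: "B n \<le> \<epsilon> / 3"
      have ex: "\<forall>l\<in>terms. \<exists>J. (\<forall>w w'. X l w = X l w' \<and> run (ps n) w = run (ps n) w' \<longrightarrow> J w = J w') \<and>
          1 - B n \<le> measure_pmf.prob (iid P n) {w. J w = K n w}"
        using good_dec[of n] unfolding ijk run K_def by simp
      from bchoice[OF ex] obtain Jl where Jl: "\<forall>l\<in>terms. (\<forall>w w'. X l w = X l w' \<and> run (ps n) w = run (ps n) w' \<longrightarrow> Jl l w = Jl l w') \<and>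
          1 - B n \<le> measure_pmf.prob (iid P n) {w. Jl l w = K n w}"
        by (rule exE)
      have Jl_prob: "1 - B n \<le> measure_pmf.prob (iid P n) {w. Jl l w = K n w}" if "l \<in> terms" for l
        by (rule bspec[OF Jl that, THEN conjunct2])
      have Jl_loc: "Jl l w = Jl l w'" if "l \<in> terms" "X l w = X l w'" "run (ps n) w = run (ps n) w'" for l w w'
        by (rule bspec[OF Jl that(1), THEN conjunct1, rule_format, OF conjI[OF that(2,3)]])
      have "1 - 3 * B n \<le> measure_pmf.prob (iid P n) {w. Jl i w = K n w \<and> Jl j w = K n w \<and> Jl k w = K n w}"
        by (intro prob_all3_ge Jl_prob mem)
      moreover have "{w. \<forall>i\<in>terms. Jl i w = K n w} = {w. Jl i w = K n w \<and> Jl j w = K n w \<and> Jl k w = K n w}"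
        by (auto simp: ijk)
      ultimately have "1 - \<epsilon> \<le> measure_pmf.prob (iid P n) {w. \<forall>i\<in>terms. Jl i w = K n w}"
        using Bn by simp
      moreover have "\<forall>l\<in>terms. \<forall>w w'. local_eq l w w' \<and> run (ps n) w = run (ps n) w' \<longrightarrow> Jl l w = Jl l w'"
        by (intro ballI allI impI, elim conjE, rule Jl_loc) (simp_all add: local_eq_iff X1)
      ultimately show "\<exists>Jl :: nat \<Rightarrow> ('a \<times> 'b \<times> 'c) list \<Rightarrow> nat.
        (\<forall>i\<in>terms. \<forall>w w'. local_eq i w w' \<and> run (ps n) w = run (ps n) w' \<longrightarrow> Jl i w = Jl i w') \<and>
        1 - \<epsilon> \<le> measure_pmf.prob (iid P n) {w. \<forall>i\<in>terms. Jl i w = K n w}"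
        by (intro exI[of _ Jl] conjI)
    qed (use \<epsilon> in simp)
  qed
  have key: "mutinf (iid P n) (K n) (run (ps n)) \<le> B n \<and> log 2 (M n) - B n \<le> ent (map_pmf (K n) (iid P n))" for n
    unfolding K_def
    by (rule mutinf_le_entropy_gap[where ?f1.0 = "\<lambda>w. f1 n (X i w)" and ?f2.0 = "\<lambda>w. f2 n (X j w)", OF _ good_bnd run good_gap])
       (simp add: finite_set_iid)
  have "\<forall>\<^sub>F n in sequentially. mutinf (iid P n) (K n) (run (ps n)) \<le> \<epsilon> \<and>
            ent (map_pmf (K n) (iid P n)) / real n \<ge> RK - \<epsilon>" if \<epsilon>: "0 < \<epsilon>" for \<epsilon>
    using eventually_conj[OF B_small[OF \<epsilon>] eventually_gt_at_top[of 0]]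
  proof (rule eventually_mono)
    fix n assume n: "B n \<le> \<epsilon> \<and> 0 < n"
    have "real n * RK = log 2 (2 powr (real n * RK))" by simp
    also have "\<dots> \<le> log 2 (M n)" using M(1)[of n] M(3)[of n] by (subst log_le_cancel_iff) auto
    finally have "real n * RK - \<epsilon> \<le> ent (map_pmf (K n) (iid P n))" using key[of n] n by linarith
    moreover have "\<epsilon> \<le> n * \<epsilon>" using n \<epsilon> by (simp add: Suc_le_eq)
    ultimately have "real n * (RK - \<epsilon>) \<le> ent (map_pmf (K n) (iid P n))" by (simp add: right_diff_distrib)
    then show "mutinf (iid P n) (K n) (run (ps n)) \<le> \<epsilon> \<and> ent (map_pmf (K n) (iid P n)) / real n \<ge> RK - \<epsilon>"
      using key[of n] n by (auto simp: field_simps)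
  qed
  then show ?thesis
    unfolding sk_achievable_def Ik_def[symmetric] RK_def[symmetric] using valid cr by blast
qed

text \<open>Silence with a constant key. It makes the set of rates nonempty, so its supremum is
  meaningful.\<close>

lemma sk_achievable_0:
  fixes P :: "('a::finite \<times> 'b::finite \<times> 'c::finite) pmf"
  shows "sk_achievable P T 0"
proof -
  have "run [] = (\<lambda>w :: ('a \<times> 'b \<times> 'c) list. [])" by (simp add: run_def fun_eq_iff)
  then have "mutinf p (\<lambda>w. 0::nat) (run []) = 0" for p :: "('a \<times> 'b \<times> 'c) list pmf"
    by (simp add: mutinf_def ent_return)
  then have "\<forall>\<epsilon>>0. \<forall>\<^sub>F n in sequentially. mutinf (iid P n) (\<lambda>w. 0::nat) (run []) \<le> \<epsilon> \<and>
      ent (map_pmf (\<lambda>w. 0::nat) (iid P n)) / real n \<ge> 0 - \<epsilon>"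
    by (simp add: ent_return)
  moreover have "is_CR P (\<lambda>_. []) (\<lambda>_ _. 0)"
    unfolding is_CR_def by (intro allI impI always_eventually exI[of _ "\<lambda>_ _. 0"]) simp
  ultimately show ?thesis
    unfolding sk_achievable_def
    by (intro exI[of _ "\<lambda>_. []"] exI[of _ "\<lambda>_ _. 0"]) (auto simp: valid_protocol_def)
qed

section \<open>Capacity bounds with one silent terminal\<close>

lemma sk_cap_T_le:
  fixes P :: "('a::finite \<times> 'b::finite \<times> 'c::finite) pmf"
  assumes "i \<in> terms" "j \<in> terms"
  shows "sk_cap_T P {i, j} \<le> HA P {i} + HA P {j} - HA P {i, j}"
  unfolding sk_cap_T_def
  using sk_achievable_0 sk_rate_le_mutual_information[OF assms] by (intro cSup_least) auto

lemma sk_cap_T_ge: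
  fixes P :: "('a::finite \<times> 'b::finite \<times> 'c::finite) pmf"
  assumes ijk: "terms = {i, j, k}"
    and le: "HA P {i, j} + HA P {k} - HA P terms \<le> HA P {i} + HA P {j} - HA P {i, j}"
  shows "HA P {i, j} + HA P {k} - HA P terms \<le> sk_cap_T P {i, j}"
proof -
  let ?I = "HA P {i, j} + HA P {k} - HA P terms"
  have "bdd_above {R. sk_achievable P {i, j} R}"
    using sk_rate_le_mutual_information[of i j P] ijk by (auto simp: bdd_above_def)
  then have up: "R \<le> sk_cap_T P {i, j}" if "sk_achievable P {i, j} R" for R
    unfolding sk_cap_T_def using that by (intro cSup_upper) auto
  show ?thesis
  \<comment> \<open>The coding lemma needs room for \<open>2 * \<delta> \<le> ?I\<close> with
    positive \<open>\<delta>\<close>; otherwise rate 0 suffices.\<close>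
  proof (cases "?I \<le> 0")
    case True
    then show ?thesis using up[OF sk_achievable_0] by simp
  next
    case False
    have "?I \<le> sk_cap_T P {i, j} + e" if e: "0 < e" for e
    proof -
      define \<delta> where "\<delta> = min (e / 2) (?I / 2)"
      have \<delta>: "0 < \<delta>" "2 * \<delta> \<le> ?I" "2 * \<delta> \<le> e" using e False by (auto simp: \<delta>_def min_def)
      show ?thesis using up[OF sk_achievable_two_transmitters[OF ijk \<delta>(1,2) le]] \<delta>(3) by linarith
    qed
    then show ?thesis by (rule field_le_epsilon)
  qed
qed

section \<open>The partitions of three terminals\<close>

lemma partition_on_eqI:
  assumes "partition_on A Q" "R \<subseteq> Q" "\<Union>R = A"
  shows "Q = R"
proof
  show "Q \<subseteq> R"
  proof
    fix X assume X: "X \<in> Q"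
    then have "X \<noteq> {}" using assms(1) by (auto simp: partition_on_def)
    then obtain x where x: "x \<in> X" by auto
    then have "x \<in> \<Union>R" using assms(1,3) X by (auto simp: partition_on_def)
    then obtain Y where Y: "Y \<in> R" "x \<in> Y" by auto
    then have "X = Y" using assms(1,2) X x by (auto simp: partition_on_def disjoint_def)
    then show "X \<in> R" using Y by simp
  qed
qed (rule assms(2))

text \<open>The cells \<open>A\<close>, \<open>B\<close>, \<open>C\<close> of 1, 2, 3 already cover
  everything, so they are the whole partition, and the cases record which of them coincide. Having
  two cells excludes that all three do.\<close>

lemma admissible_partitions:
  "{Q. admissible_partition Q} = {singleton_partition, {{1, 2}, {3}}, {{1, 3}, {2}}, {{2, 3}, {1}}}"
proof (intro equalityI subsetI)
  fix Q assume "Q \<in> {Q. admissible_partition Q}"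
  then have Q: "partition_on {1, 2, 3} Q" and card: "card Q \<ge> 2" by (auto simp: admissible_partition_def terms_def)
  have cover: "\<Union>Q = {1, 2, 3}" and disj: "\<And>X Y. X \<in> Q \<Longrightarrow> Y \<in> Q \<Longrightarrow> X \<inter> Y \<noteq> {} \<Longrightarrow> X = Y"
    using Q by (auto simp: partition_on_def disjoint_def)
  obtain A B C where mem: "A \<in> Q" "B \<in> Q" "C \<in> Q" and in_mem: "1 \<in> A" "2 \<in> B" "3 \<in> C"
  proof -
    have "1 \<in> \<Union>Q" "2 \<in> \<Union>Q" "3 \<in> \<Union>Q" using cover by auto
    then show ?thesis using that by blast
  qed
  have sub: "A \<subseteq> {1, 2, 3}" "B \<subseteq> {1, 2, 3}" "C \<subseteq> {1, 2, 3}" using mem cover by auto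
  have Q_eq: "Q = {A, B, C}"
    by (rule partition_on_eqI[OF Q]) (use mem in_mem sub in auto)
  have AB: "2 \<in> A \<or> 1 \<in> B \<Longrightarrow> A = B" and AC: "3 \<in> A \<or> 1 \<in> C \<Longrightarrow> A = C" and BC: "3 \<in> B \<or> 2 \<in> C \<Longrightarrow> B = C"
    using disj[of A B] disj[of A C] disj[of B C] mem in_mem by blast+
  have "\<not> (A = B \<and> A = C)" using card Q_eq by auto
  then consider "A = B" "A \<noteq> C" | "A = C" "A \<noteq> B" | "B = C" "A \<noteq> B" | "A \<noteq> B" "A \<noteq> C" "B \<noteq> C" by auto
  then show "Q \<in> {singleton_partition, {{1, 2}, {3}}, {{1, 3}, {2}}, {{2, 3}, {1}}}"
  proof cases
    case 1
    then have "A = {1, 2}" "C = {3}" using sub in_mem AC BC by blast+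
    then show ?thesis using Q_eq 1 by simp
  next
    case 2
    then have "A = {1, 3}" "B = {2}" using sub in_mem AB BC by blast+
    then show ?thesis using Q_eq 2 by auto
  next
    case 3
    then have "B = {2, 3}" "A = {1}" using sub in_mem AB AC by blast+
    then show ?thesis using Q_eq 3 by auto
  next
    case 4
    then have "A = {1}" "B = {2}" "C = {3}" using sub in_mem AB AC BC by blast+
    then show ?thesis using Q_eq by (simp add: singleton_partition_def)
  qed
next
  fix Q :: "nat set set"
  assume "Q \<in> {singleton_partition, {{1, 2}, {3}}, {{1, 3}, {2}}, {{2, 3}, {1}}}"
  then show "Q \<in> {Q. admissible_partition Q}"
    by (auto simp: admissible_partition_def singleton_partition_def partition_on_def disjoint_def terms_def card_insert_if doubleton_eq_iff)
qed

theorem theorem5: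
  fixes P :: "('a::finite \<times> 'b::finite \<times> 'c::finite) pmf"
  shows "((\<forall>T. T \<subseteq> terms \<and> card T = 2 \<longrightarrow> sk_cap_T P T < mmi P) \<longleftrightarrow>
          (Delta P singleton_partition = mmi P \<and>
           (\<forall>Q. admissible_partition Q \<and> Delta P Q = mmi P \<longrightarrow> Q = singleton_partition)))
       \<and> ((Delta P singleton_partition = mmi P \<and>
           (\<forall>Q. admissible_partition Q \<and> Delta P Q = mmi P \<longrightarrow> Q = singleton_partition)) \<longleftrightarrow>
          Delta P singleton_partition <
            min (HA P {1,2} + HA P {3} - HA P terms)
              (min (HA P {1,3} + HA P {2} - HA P terms)
                   (HA P {2,3} + HA P {1} - HA P terms)))"
proof -
  define D12 where "D12 = HA P {1,2} + HA P {3} - HA P terms"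
  define D13 where "D13 = HA P {1,3} + HA P {2} - HA P terms"
  define D23 where "D23 = HA P {2,3} + HA P {1} - HA P terms"
  define S where "S = Delta P singleton_partition"
  \<comment> \<open>Adding and subtracting \<open>HA P {i, j}\<close> writes \<open>2 * S\<close> as
    \<open>I(i;j)\<close> plus the value of the partition that isolates k. Hence \<open>S\<close>
    lies between these two numbers.\<close>
  have S: "2 * S = HA P {1} + HA P {2} + HA P {3} - HA P terms"
    by (simp add: S_def Delta_def singleton_partition_def)
  have Delta2: "Delta P {{1, 2}, {3}} = D12" "Delta P {{1, 3}, {2}} = D13" "Delta P {{2, 3}, {1}} = D23"
    by (simp_all add: Delta_def D12_def D13_def D23_def)
  have mmi: "mmi P = min S (min D12 (min D13 D23))"
    unfolding mmi_def admissible_partitions by (simp only: image_insert image_empty Delta2 S_def[symmetric]) simp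
  have adm: "admissible_partition Q \<longleftrightarrow>
      Q = singleton_partition \<or> Q = {{1, 2}, {3}} \<or> Q = {{1, 3}, {2}} \<or> Q = {{2, 3}, {1}}" for Q
  proof -
    have "admissible_partition Q \<longleftrightarrow> Q \<in> {Q. admissible_partition Q}" by simp
    then show ?thesis unfolding admissible_partitions by simp
  qed
  have ne: "{{1, 2}, {3}} \<noteq> singleton_partition" "{{1, 3}, {2}} \<noteq> singleton_partition" "{{2, 3}, {1}} \<noteq> singleton_partition"
  proof -
    have "{1} \<in> singleton_partition" "{2} \<in> singleton_partition" by (simp_all add: singleton_partition_def)
    moreover have "{1} \<notin> {{1, 2}, {3 :: nat}}" "{1} \<notin> {{1, 3}, {2 :: nat}}" "{2} \<notin> {{2, 3}, {1 :: nat}}"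
      by simp_all
    ultimately show "{{1, 2}, {3}} \<noteq> singleton_partition" "{{1, 3}, {2}} \<noteq> singleton_partition" "{{2, 3}, {1}} \<noteq> singleton_partition"
      by blast+
  qed
  have unique: "(Delta P singleton_partition = mmi P \<and>
      (\<forall>Q. admissible_partition Q \<and> Delta P Q = mmi P \<longrightarrow> Q = singleton_partition)) \<longleftrightarrow> S < min D12 (min D13 D23)"
    (is "?U \<longleftrightarrow> _")
  proof
    assume U: ?U
    have "D \<noteq> mmi P" if "admissible_partition Q" "Q \<noteq> singleton_partition" "Delta P Q = D" for D Q
      using U that by auto
    from this[OF _ ne(1) Delta2(1)] this[OF _ ne(2) Delta2(2)] this[OF _ ne(3) Delta2(3)]
    have "D12 \<noteq> mmi P" "D13 \<noteq> mmi P" "D23 \<noteq> mmi P" by (simp_all add: adm)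
    moreover have "S = mmi P" using U by (simp add: S_def)
    ultimately show "S < min D12 (min D13 D23)" unfolding mmi by (auto simp: min_def split: if_splits)
  next
    assume less: "S < min D12 (min D13 D23)"
    then have "mmi P = S" by (simp add: mmi)
    moreover have "S \<noteq> D12" "S \<noteq> D13" "S \<noteq> D23" using less by auto
    ultimately show ?U
      unfolding adm by (auto simp only: Delta2 S_def[symmetric])
  qed
  have cap: "sk_cap_T P {i, j} \<le> HA P {i} + HA P {j} - HA P {i, j}"
    "HA P {i, j} + HA P {k} - HA P terms \<le> HA P {i} + HA P {j} - HA P {i, j} \<Longrightarrow>
      HA P {i, j} + HA P {k} - HA P terms \<le> sk_cap_T P {i, j}"
    if "terms = {i, j, k}" for i j k
    using that by (auto intro!: sk_cap_T_le sk_cap_T_ge[of i j k P])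
  \<comment> \<open>Each listing puts the silent terminal last.\<close>
  have t: "terms = {1, 2, 3}" "terms = {1, 3, 2}" "terms = {2, 3, 1}" by (auto simp: terms_def)
  have T: "T = {1, 2} \<or> T = {1, 3} \<or> T = {2, 3}" if "T \<subseteq> terms" "card T = 2" for T
    using that by (auto simp: card_2_iff terms_def)
  have T': "{1, 2} \<subseteq> terms \<and> card {1, 2 :: nat} = 2" "{1, 3} \<subseteq> terms \<and> card {1, 3 :: nat} = 2"
    "{2, 3} \<subseteq> terms \<and> card {2, 3 :: nat} = 2" by (auto simp: terms_def)
  have "(\<forall>T. T \<subseteq> terms \<and> card T = 2 \<longrightarrow> sk_cap_T P T < mmi P) \<longleftrightarrow> S < min D12 (min D13 D23)"
  proof
    assume L: "\<forall>T. T \<subseteq> terms \<and> card T = 2 \<longrightarrow> sk_cap_T P T < mmi P"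
    note lt = L[rule_format, OF T'(1)] L[rule_format, OF T'(2)] L[rule_format, OF T'(3)]
    show "S < min D12 (min D13 D23)"
    proof (rule ccontr)
      assume "\<not> ?thesis"
      then consider "mmi P = D12" "D12 \<le> S" | "mmi P = D13" "D13 \<le> S" | "mmi P = D23" "D23 \<le> S"
        unfolding mmi by (cases "D12 \<le> min D13 D23"; cases "D13 \<le> D23") (auto simp: min_def split: if_splits)
      then show False
      proof cases
        case 1
        \<comment> \<open>\<open>D12 \<le> S\<close> amounts to \<open>D12 \<le> I(1;2)\<close>, so
          terminals 1 and 2 alone achieve \<open>D12 = mmi P\<close>, against
          \<open>lt(1)\<close>.\<close>
        then show False using lt(1) cap(2)[OF t(1)] S unfolding D12_def by linarith
      next
        case 2
        then show False using lt(2) cap(2)[OF t(2)] S unfolding D13_def by linarith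
      next
        case 3
        then show False using lt(3) cap(2)[OF t(3)] S unfolding D23_def by linarith
      qed
    qed
  next
    assume less: "S < min D12 (min D13 D23)"
    then have "mmi P = S" by (simp add: mmi)
    \<comment> \<open>\<open>S < D12\<close> amounts to \<open>I(1;2) < S\<close>, and
      \<open>I(1;2)\<close> bounds the capacity with terminal 3 silent.\<close>
    moreover have "sk_cap_T P {1, 2} < S" using less cap(1)[OF t(1)] S unfolding D12_def by simp
    moreover have "sk_cap_T P {1, 3} < S" using less cap(1)[OF t(2)] S unfolding D13_def by simp
    moreover have "sk_cap_T P {2, 3} < S" using less cap(1)[OF t(3)] S unfolding D23_def by simp
    ultimately have "sk_cap_T P T < mmi P" if "T \<subseteq> terms" "card T = 2" for T
      using T[OF that] by (elim disjE) simp_all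
    then show "\<forall>T. T \<subseteq> terms \<and> card T = 2 \<longrightarrow> sk_cap_T P T < mmi P" by simp
  qed
  with unique show ?thesis unfolding D12_def D13_def D23_def S_def by blast
qed

end
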